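(* Let $k\ge1$ and let $V$ be a $\hat{\mathfrak g}_k^{(k)}$-module on which $d_k$ acts diagonalizably with real eigenvalues that are bounded above. Then, for $x\in\mathfrak g$ and ${\bf n}=(n_1,\dots,n_k)\in\mathbb{Z}^k$ such that ${\bf n}'\neq{\bf 0}$, the commutator $[x({\bf n}),L_0^{(k)}]$ as an operator on $V$ is given by \begin{align*} [x({\bf n}),L_0^{(k)}]={}&\sum_j\Big(-\sum_{d<\frac{n_k}{2}}e_j({\bf n}'+d)\cdot[x,e^j](n_k-d)+\sum_{d<\frac{n_k}{2}}e_j(d)\cdot[x,e^j]({\bf n}-d)\Big)\\ &+\sum_j\Big(-\frac12 e_j\big({\bf n}'+\tfrac{n_k}{2}\big)\cdot[x,e^j]\big(\tfrac{n_k}{2}\big)+\frac12 e_j\big(\tfrac{n_k}{2}\big)\cdot[x,e^j]\big({\bf n}-\tfrac{n_k}{2}\big)\Big)+h^\vee n_k\,x({\bf n}), \end{align*} where $d$ runs over integers and the terms involving $\frac{n_k}{2}$ in the second line are taken to be zero if $n_k$ is odd.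
   Context: $\mathfrak g$ is a simple Lie algebra over $\mathbb{C}$ with Cartan subalgebra $\mathfrak t$, highest root $\theta$, dual Coxeter number $h^\vee$, and invariant form $\langle\,,\,\rangle$ normalized so that $\langle\theta,\theta\rangle=2$ on $\mathfrak t^*$. Let $A_k=\mathbb{C}[t_1^{\pm1},\dots,t_k^{\pm1}]$, ${\bf t}^{\bf n}=t_1^{n_1}\cdots t_k^{n_k}$, and $$\tilde{\mathfrak g}_k=(\mathfrak g\otimes A_k)\oplus\bigoplus_{i=1}^k\mathbb{C}c_i,\qquad \hat{\mathfrak g}_k^{(k)}=\tilde{\mathfrak g}_k\oplus\mathbb{C}d_k,$$ with $c_i$ central, $[x\otimes{\bf t}^{\bf n},y\otimes{\bf t}^{\bf m}]=[x,y]\otimes{\bf t}^{{\bf n}+{\bf m}}+\delta_{{\bf n}+{\bf m},0}\langle x,y\rangle\sum_i n_ic_i$, $[d_k,x\otimes{\bf t}^{\bf n}]=n_k\,x\otimes{\bf t}^{\bf n}$, $[d_k,c_j]=0$. Notation: write ${\bf n}=n_1\delta_1+\cdots+n_k\delta_k$, where $\delta_i$ is the $i$-th standard basis vector of $\mathbb{Z}^k$, and ${\bf n}'={\bf n}-n_k\delta_k$. Set $x({\bf n})=x\otimes{\bf t}^{\bf n}$. An integer $d$ in such an argument stands for $d\delta_k$; thus $x({\bf n}+d)=x\otimes({\bf t}^{\bf n}t_k^d)$ and $x(d)=x\otimes t_k^d$. $\{e_j\}$ is a basis of $\mathfrak g$ and $\{e^j\}$ the dual basis with respect to $\langle\,,\,\rangle$.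 The Sugawara operator is $$L_0^{(k)}=\frac12\sum_j\sum_{d\in\mathbb{Z}}:e_j(-d)\cdot e^j(d):,$$ where the normal ordering is $:e_j(-d)\cdot e^j(d):\;=e_j(-d)\cdot e^j(d)$ if $d\ge0$ and $=e^j(d)\cdot e_j(-d)$ if $d<0$. It lies in the completion $\hat U((\mathfrak g\otimes\mathbb{C}[t_k^{\pm1}])\oplus\mathbb{C}c_k)$ of the enveloping algebra along the positive root spaces, and acts on $V$ since on each vector only finitely many terms are nonzero. *)

theory Defs
  imports "HOL-Analysis.Analysis" "HOL-Library.Poly_Mapping" "HOL-Library.Groups_Big_Fun"
begin

section \<open>Complex Lie algebras and their modules\<close>

locale lie_algebra = vector_space sc
  for sc :: "complex \<Rightarrow> 'g::ab_group_add \<Rightarrow> 'g" +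
  fixes brk :: "'g \<Rightarrow> 'g \<Rightarrow> 'g"
  assumes brk_add_left: "brk (x + y) z = brk x z + brk y z"
    and brk_add_right: "brk x (y + z) = brk x y + brk x z"
    and brk_scale_left: "brk (sc a x) y = sc a (brk x y)"
    and brk_scale_right: "brk x (sc a y) = sc a (brk x y)"
    and brk_self: "brk x x = 0"
    and jacobi: "brk x (brk y z) + brk y (brk z x) + brk z (brk x y) = 0"

definition (in lie_algebra) lie_ideal :: "'g set \<Rightarrow> bool" where
  "lie_ideal I \<longleftrightarrow> subspace I \<and> (\<forall>x. \<forall>y\<in>I. brk x y \<in> I)"

locale simple_lie_algebra = lie_algebra +
  assumes finite_dimensional: "\<exists>S. finite S \<and> span S = UNIV"
    and nonabelian: "\<exists>x y. brk x y \<noteq> 0"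
    and only_trivial_ideals: "lie_ideal I \<Longrightarrow> I = {0} \<or> I = UNIV"

locale lie_module =
  L: lie_algebra scaleL brk + V: vector_space scaleV
  for scaleL :: "complex \<Rightarrow> 'l::ab_group_add \<Rightarrow> 'l"
    and brk :: "'l \<Rightarrow> 'l \<Rightarrow> 'l"
    and scaleV :: "complex \<Rightarrow> 'v::ab_group_add \<Rightarrow> 'v" +
  fixes act :: "'l \<Rightarrow> 'v \<Rightarrow> 'v"
  assumes act_add_left: "act (X + Y) v = act X v + act Y v"
    and act_scale_left: "act (scaleL a X) v = scaleV a (act X v)"
    and act_add_right: "act X (v + w) = act X v + act X w"
    and act_scale_right: "act X (scaleV a v) = scaleV a (act X v)"
    and act_brk: "act (brk X Y) v = act X (act Y v) - act Y (act X v)"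

definition diagonalizable :: "(complex \<Rightarrow> 'v::ab_group_add \<Rightarrow> 'v) \<Rightarrow> ('v \<Rightarrow> 'v) \<Rightarrow> bool" where
  "diagonalizable sc T \<longleftrightarrow> module.span sc {v. \<exists>a. T v = sc a v} = UNIV"

definition eigenvalue :: "(complex \<Rightarrow> 'v::ab_group_add \<Rightarrow> 'v) \<Rightarrow> ('v \<Rightarrow> 'v) \<Rightarrow> complex \<Rightarrow> bool" where
  "eigenvalue sc T a \<longleftrightarrow> (\<exists>v. v \<noteq> 0 \<and> T v = sc a v)"

definition real_eigenvalues_bounded_above ::
    "(complex \<Rightarrow> 'v::ab_group_add \<Rightarrow> 'v) \<Rightarrow> ('v \<Rightarrow> 'v) \<Rightarrow> bool" where
  "real_eigenvalues_bounded_above sc T \<longleftrightarrow>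
     (\<exists>M. \<forall>a. eigenvalue sc T a \<longrightarrow> a \<in> \<real> \<and> Re a \<le> M)"

section \<open>Roots, invariant form, dual Coxeter number\<close>

text \<open>For a complex semisimple Lie algebra: a self-centralizing abelian subspace acting by
  diagonalizable operators.\<close>

definition cartan_subalgebra ::
    "(complex \<Rightarrow> 'g::ab_group_add \<Rightarrow> 'g) \<Rightarrow> ('g \<Rightarrow> 'g \<Rightarrow> 'g) \<Rightarrow> 'g set \<Rightarrow> bool" where
  "cartan_subalgebra sc brk H \<longleftrightarrow>
     module.subspace sc H \<and>
     (\<forall>h\<in>H. \<forall>h'\<in>H. brk h h' = 0) \<and>
     (\<forall>x. (\<forall>h\<in>H. brk h x = 0) \<longrightarrow> x \<in> H) \<and>
     (\<forall>h\<in>H. diagonalizable sc (brk h))"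

text \<open>A functional on \<open>H\<close> is represented by its extension by \<open>0\<close> to the complement of the set
  \<open>H\<close>, so that equality of functions is equality of functionals. Linearity on \<open>H\<close> of a root
  follows from its root space being nonzero.\<close>

definition roots ::
    "(complex \<Rightarrow> 'g::ab_group_add \<Rightarrow> 'g) \<Rightarrow> ('g \<Rightarrow> 'g \<Rightarrow> 'g) \<Rightarrow> 'g set \<Rightarrow> ('g \<Rightarrow> complex) set" where
  "roots sc brk H =
     {\<alpha>. (\<forall>h. h \<notin> H \<longrightarrow> \<alpha> h = 0) \<and> (\<exists>h\<in>H. \<alpha> h \<noteq> 0) \<and>
         (\<exists>x. x \<noteq> 0 \<and> (\<forall>h\<in>H. brk h x = sc (\<alpha> h) x))}"

definition nat_span :: "('g \<Rightarrow> complex) set \<Rightarrow> ('g \<Rightarrow> complex) set" where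
  "nat_span \<Delta> = {\<lambda>h. \<Sum>\<alpha>\<in>\<Delta>. of_nat (m \<alpha>) * \<alpha> h | m. True}"

definition root_base ::
    "(complex \<Rightarrow> 'g::ab_group_add \<Rightarrow> 'g) \<Rightarrow> ('g \<Rightarrow> 'g \<Rightarrow> 'g) \<Rightarrow> 'g set \<Rightarrow> ('g \<Rightarrow> complex) set \<Rightarrow> bool"
  where
  "root_base sc brk H \<Delta> \<longleftrightarrow>
     finite \<Delta> \<and> \<Delta> \<subseteq> roots sc brk H \<and>
     (\<forall>c :: ('g \<Rightarrow> complex) \<Rightarrow> complex.
        (\<forall>h. (\<Sum>\<alpha>\<in>\<Delta>. c \<alpha> * \<alpha> h) = 0) \<longrightarrow> (\<forall>\<alpha>\<in>\<Delta>. c \<alpha> = 0)) \<and>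
     (\<forall>\<beta>\<in>roots sc brk H. \<beta> \<in> nat_span \<Delta> \<or> (\<lambda>h. - \<beta> h) \<in> nat_span \<Delta>)"

definition positive_roots ::
    "(complex \<Rightarrow> 'g::ab_group_add \<Rightarrow> 'g) \<Rightarrow> ('g \<Rightarrow> 'g \<Rightarrow> 'g) \<Rightarrow> 'g set \<Rightarrow> ('g \<Rightarrow> complex) set \<Rightarrow>
      ('g \<Rightarrow> complex) set" where
  "positive_roots sc brk H \<Delta> = roots sc brk H \<inter> nat_span \<Delta>"

definition highest_root ::
    "(complex \<Rightarrow> 'g::ab_group_add \<Rightarrow> 'g) \<Rightarrow> ('g \<Rightarrow> 'g \<Rightarrow> 'g) \<Rightarrow> 'g set \<Rightarrow> ('g \<Rightarrow> complex) set \<Rightarrow>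
      ('g \<Rightarrow> complex) \<Rightarrow> bool" where
  "highest_root sc brk H \<Delta> \<theta> \<longleftrightarrow>
     \<theta> \<in> roots sc brk H \<and> (\<forall>\<beta>\<in>roots sc brk H. (\<lambda>h. \<theta> h - \<beta> h) \<in> nat_span \<Delta>)"

definition invariant_form ::
    "(complex \<Rightarrow> 'g::ab_group_add \<Rightarrow> 'g) \<Rightarrow> ('g \<Rightarrow> 'g \<Rightarrow> 'g) \<Rightarrow> ('g \<Rightarrow> 'g \<Rightarrow> complex) \<Rightarrow> bool" where
  "invariant_form sc brk B \<longleftrightarrow>
     (\<forall>x y z. B (x + y) z = B x z + B y z) \<and>
     (\<forall>a x y. B (sc a x) y = a * B x y) \<and>
     (\<forall>x y. B x y = B y x) \<and>
     (\<forall>x y z. B (brk x y) z = B x (brk y z)) \<and>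
     (\<forall>x. (\<forall>y. B x y = 0) \<longrightarrow> x = 0)"

text \<open>\<open>B\<close> identifies \<open>H\<close> with its dual, which carries the form to the dual. The coroot below
  does not depend on the scaling of \<open>B\<close>.\<close>

definition dual_vec :: "('g \<Rightarrow> 'g \<Rightarrow> complex) \<Rightarrow> 'g set \<Rightarrow> ('g \<Rightarrow> complex) \<Rightarrow> 'g" where
  "dual_vec B H \<alpha> = (THE t. t \<in> H \<and> (\<forall>h\<in>H. B t h = \<alpha> h))"

definition dual_form ::
    "('g \<Rightarrow> 'g \<Rightarrow> complex) \<Rightarrow> 'g set \<Rightarrow> ('g \<Rightarrow> complex) \<Rightarrow> ('g \<Rightarrow> complex) \<Rightarrow> complex" where
  "dual_form B H \<alpha> \<beta> = B (dual_vec B H \<alpha>) (dual_vec B H \<beta>)"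

definition coroot ::
    "(complex \<Rightarrow> 'g \<Rightarrow> 'g) \<Rightarrow> ('g \<Rightarrow> 'g \<Rightarrow> complex) \<Rightarrow> 'g set \<Rightarrow> ('g \<Rightarrow> complex) \<Rightarrow> 'g" where
  "coroot sc B H \<alpha> = sc (2 / dual_form B H \<alpha> \<alpha>) (dual_vec B H \<alpha>)"

definition half_sum_positive_roots ::
    "(complex \<Rightarrow> 'g::ab_group_add \<Rightarrow> 'g) \<Rightarrow> ('g \<Rightarrow> 'g \<Rightarrow> 'g) \<Rightarrow> 'g set \<Rightarrow> ('g \<Rightarrow> complex) set \<Rightarrow>
      'g \<Rightarrow> complex" where
  "half_sum_positive_roots sc brk H \<Delta> h = (\<Sum>\<beta>\<in>positive_roots sc brk H \<Delta>. \<beta> h) / 2"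

definition dual_coxeter_number ::
    "(complex \<Rightarrow> 'g::ab_group_add \<Rightarrow> 'g) \<Rightarrow> ('g \<Rightarrow> 'g \<Rightarrow> 'g) \<Rightarrow> ('g \<Rightarrow> 'g \<Rightarrow> complex) \<Rightarrow> 'g set \<Rightarrow>
      ('g \<Rightarrow> complex) set \<Rightarrow> ('g \<Rightarrow> complex) \<Rightarrow> complex" where
  "dual_coxeter_number sc brk B H \<Delta> \<theta> =
     1 + half_sum_positive_roots sc brk H \<Delta> (coroot sc B H \<theta>)"

definition dual_bases ::
    "(complex \<Rightarrow> 'g::ab_group_add \<Rightarrow> 'g) \<Rightarrow> ('g \<Rightarrow> 'g \<Rightarrow> complex) \<Rightarrow>
      ('j \<Rightarrow> 'g) \<Rightarrow> ('j \<Rightarrow> 'g) \<Rightarrow> bool" where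
  "dual_bases sc B e e' \<longleftrightarrow>
     inj e \<and> \<not> module.dependent sc (range e) \<and> module.span sc (range e) = UNIV \<and>
     (\<forall>i j. B (e i) (e' j) = (if i = j then 1 else 0))"

section \<open>The toroidal Lie algebra with one derivation\<close>

text \<open>The triple \<open>(f, c, a)\<close> stands for the sum of all \<open>f n \<otimes> t^n\<close>, all \<open>c $ i\<close> times the
  \<open>i\<close>-th central generator, and \<open>a\<close> times the derivation. The variables are indexed by the
  finite type \<open>'k\<close>; the derivation belongs to the variable with index \<open>l\<close>.\<close>

type_synonym ('g, 'k) toroidal = "((int ^ 'k) \<Rightarrow>\<^sub>0 'g) \<times> (complex ^ 'k) \<times> complex"

definition loop :: "'g::ab_group_add \<Rightarrow> int ^ 'k::finite \<Rightarrow> ('g, 'k) toroidal" where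
  "loop x n = (Poly_Mapping.single n x, 0, 0)"

definition centr :: "'k::finite \<Rightarrow> ('g::ab_group_add, 'k) toroidal" where
  "centr i = (0, axis i 1, 0)"

definition deriv_elt :: "('g::ab_group_add, 'k::finite) toroidal" where
  "deriv_elt = (0, 0, 1)"

definition loop_scale ::
    "(complex \<Rightarrow> 'g \<Rightarrow> 'g) \<Rightarrow> (int ^ 'k::finite \<Rightarrow> complex) \<Rightarrow> ((int ^ 'k) \<Rightarrow>\<^sub>0 'g::ab_group_add) \<Rightarrow>
      ((int ^ 'k) \<Rightarrow>\<^sub>0 'g)" where
  "loop_scale sc w f =
     (\<Sum>n\<in>Poly_Mapping.keys f. Poly_Mapping.single n (sc (w n) (Poly_Mapping.lookup f n)))"

definition toroidal_scale ::
    "(complex \<Rightarrow> 'g \<Rightarrow> 'g) \<Rightarrow> complex \<Rightarrow> ('g::ab_group_add, 'k::finite) toroidal \<Rightarrow> ('g, 'k) toroidal"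
  where
  "toroidal_scale sc a = (\<lambda>(f, c, b). (loop_scale sc (\<lambda>n. a) f, a *s c, a * b))"

definition loop_bracket ::
    "('g \<Rightarrow> 'g \<Rightarrow> 'g) \<Rightarrow> ((int ^ 'k::finite) \<Rightarrow>\<^sub>0 'g::ab_group_add) \<Rightarrow> ((int ^ 'k) \<Rightarrow>\<^sub>0 'g) \<Rightarrow>
      ((int ^ 'k) \<Rightarrow>\<^sub>0 'g)" where
  "loop_bracket brk f g =
     (\<Sum>n\<in>Poly_Mapping.keys f. \<Sum>m\<in>Poly_Mapping.keys g.
        Poly_Mapping.single (n + m) (brk (Poly_Mapping.lookup f n) (Poly_Mapping.lookup g m)))"

definition loop_cocycle ::
    "('g \<Rightarrow> 'g \<Rightarrow> complex) \<Rightarrow> ((int ^ 'k::finite) \<Rightarrow>\<^sub>0 'g::ab_group_add) \<Rightarrow> ((int ^ 'k) \<Rightarrow>\<^sub>0 'g) \<Rightarrow>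
      complex ^ 'k" where
  "loop_cocycle B f g =
     (\<chi> i. \<Sum>n\<in>Poly_Mapping.keys f. \<Sum>m\<in>Poly_Mapping.keys g.
        if n + m = 0 then B (Poly_Mapping.lookup f n) (Poly_Mapping.lookup g m) * of_int (n $ i) else 0)"

definition toroidal_bracket ::
    "(complex \<Rightarrow> 'g \<Rightarrow> 'g) \<Rightarrow> ('g \<Rightarrow> 'g \<Rightarrow> 'g) \<Rightarrow> ('g \<Rightarrow> 'g \<Rightarrow> complex) \<Rightarrow> 'k::finite \<Rightarrow>
      ('g::ab_group_add, 'k) toroidal \<Rightarrow> ('g, 'k) toroidal \<Rightarrow> ('g, 'k) toroidal" where
  "toroidal_bracket sc brk B l = (\<lambda>(f, c, a) (g, c', b).
     (loop_bracket brk f g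
        + loop_scale sc (\<lambda>n. a * of_int (n $ l)) g - loop_scale sc (\<lambda>n. b * of_int (n $ l)) f,
      loop_cocycle B f g, 0))"

context lie_algebra
begin

lemma brk_zero_left [simp]: "brk 0 y = 0"
  using brk_add_left[of 0 0 y] by simp

lemma brk_zero_right [simp]: "brk y 0 = 0"
  using brk_add_right[of y 0 0] by simp

lemma brk_swap: "brk x y = - brk y x"
proof -
  have "brk (x + y) (x + y) = brk x y + brk y x"
    by (simp only: brk_add_left brk_add_right) (simp add: brk_self add.commute)
  then have "brk x y + brk y x = 0"
    by (simp add: brk_self)
  then show ?thesis
    by (simp add: eq_neg_iff_add_eq_0)
qed

lemma lookup_loop_scale:
  fixes f :: "(int ^ 'n::finite) \<Rightarrow>\<^sub>0 'g"
  shows "Poly_Mapping.lookup (loop_scale sc w f) n = sc (w n) (Poly_Mapping.lookup f n)"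
proof -
  have "Poly_Mapping.lookup (loop_scale sc w f) n =
      (\<Sum>m\<in>Poly_Mapping.keys f. if m = n then sc (w m) (Poly_Mapping.lookup f m) else 0)"
    by (simp add: loop_scale_def lookup_sum lookup_single when_def)
  also have "\<dots> = sc (w n) (Poly_Mapping.lookup f n)"
    by (simp add: sum.delta in_keys_iff)
  finally show ?thesis .
qed

lemma loop_bracket_superset:
  fixes f g :: "(int ^ 'n::finite) \<Rightarrow>\<^sub>0 'g"
  assumes "finite S" "finite T" "Poly_Mapping.keys f \<subseteq> S" "Poly_Mapping.keys g \<subseteq> T"
  shows "loop_bracket brk f g =
     (\<Sum>n\<in>S. \<Sum>m\<in>T.
        Poly_Mapping.single (n + m) (brk (Poly_Mapping.lookup f n) (Poly_Mapping.lookup g m)))"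
proof -
  have 1: "(\<Sum>m\<in>T. Poly_Mapping.single (n + m) (brk x (Poly_Mapping.lookup g m))) =
      (\<Sum>m\<in>Poly_Mapping.keys g. Poly_Mapping.single (n + m) (brk x (Poly_Mapping.lookup g m)))"
    for n x
    by (rule sum.mono_neutral_right) (use assms in \<open>auto simp: in_keys_iff\<close>)
  show ?thesis
    unfolding loop_bracket_def 1
    by (rule sum.mono_neutral_left) (use assms in \<open>auto simp: in_keys_iff\<close>)
qed

lemma loop_bracket_add_left:
  fixes f f' g :: "(int ^ 'n::finite) \<Rightarrow>\<^sub>0 'g"
  shows "loop_bracket brk (f + f') g = loop_bracket brk f g + loop_bracket brk f' g"
proof -
  define S where "S = Poly_Mapping.keys f \<union> Poly_Mapping.keys f'"
  have S: "finite S" "Poly_Mapping.keys f \<subseteq> S" "Poly_Mapping.keys f' \<subseteq> S"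
      "Poly_Mapping.keys (f + f') \<subseteq> S"
    using keys_add[of f f'] by (auto simp: S_def)
  show ?thesis
    using S by (simp add: loop_bracket_superset[where S = S and T = "Poly_Mapping.keys g"]
        lookup_add brk_add_left single_add sum.distrib)
qed

lemma loop_bracket_add_right:
  fixes f g g' :: "(int ^ 'n::finite) \<Rightarrow>\<^sub>0 'g"
  shows "loop_bracket brk f (g + g') = loop_bracket brk f g + loop_bracket brk f g'"
proof -
  define T where "T = Poly_Mapping.keys g \<union> Poly_Mapping.keys g'"
  have T: "finite T" "Poly_Mapping.keys g \<subseteq> T" "Poly_Mapping.keys g' \<subseteq> T"
      "Poly_Mapping.keys (g + g') \<subseteq> T"
    using keys_add[of g g'] by (auto simp: T_def)
  show ?thesis
    using T by (simp add: loop_bracket_superset[where S = "Poly_Mapping.keys f" and T = T]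
        lookup_add brk_add_right single_add sum.distrib)
qed

lemma loop_bracket_single [simp]:
  fixes n m :: "int ^ 'n::finite"
  shows "loop_bracket brk (Poly_Mapping.single n x) (Poly_Mapping.single m y) =
     Poly_Mapping.single (n + m) (brk x y)"
  using loop_bracket_superset[of "{n}" "{m}" "Poly_Mapping.single n x" "Poly_Mapping.single m y"]
  by simp

lemma loop_bracket_zero [simp]:
  fixes f :: "(int ^ 'n::finite) \<Rightarrow>\<^sub>0 'g"
  shows "loop_bracket brk 0 f = 0" "loop_bracket brk f 0 = 0"
  by (simp_all add: loop_bracket_def)

lemma loop_scale_single [simp]:
  fixes n :: "int ^ 'n::finite"
  shows "loop_scale sc w (Poly_Mapping.single n x) = Poly_Mapping.single n (sc (w n) x)"
  by (rule poly_mapping_eqI) (simp add: lookup_loop_scale lookup_single when_def)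

lemma loop_scale_add:
  fixes f g :: "(int ^ 'n::finite) \<Rightarrow>\<^sub>0 'g"
  shows "loop_scale sc w (f + g) = loop_scale sc w f + loop_scale sc w g"
  by (rule poly_mapping_eqI) (simp add: lookup_loop_scale lookup_add scale_right_distrib)

lemma loop_scale_minus:
  fixes f :: "(int ^ 'n::finite) \<Rightarrow>\<^sub>0 'g"
  shows "loop_scale sc w (- f) = - loop_scale sc w f"
  by (rule poly_mapping_eqI) (simp add: lookup_loop_scale)

lemma loop_scale_zero [simp]: "loop_scale sc w (0 :: (int ^ 'n::finite) \<Rightarrow>\<^sub>0 'g) = 0"
  by (rule poly_mapping_eqI) (simp add: lookup_loop_scale)

lemma loop_scale_weight_add:
  fixes f :: "(int ^ 'n::finite) \<Rightarrow>\<^sub>0 'g"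
  shows "loop_scale sc (\<lambda>n. w n + w' n) f = loop_scale sc w f + loop_scale sc w' f"
  by (rule poly_mapping_eqI) (simp add: lookup_loop_scale lookup_add scale_left_distrib)

lemma loop_scale_weight_zero [simp]:
  "loop_scale sc (\<lambda>n. 0) (f :: (int ^ 'n::finite) \<Rightarrow>\<^sub>0 'g) = 0"
  by (rule poly_mapping_eqI) (simp add: lookup_loop_scale)

lemma loop_scale_loop_scale:
  fixes f :: "(int ^ 'n::finite) \<Rightarrow>\<^sub>0 'g"
  shows "loop_scale sc w (loop_scale sc w' f) = loop_scale sc (\<lambda>n. w n * w' n) f"
  by (rule poly_mapping_eqI) (simp add: lookup_loop_scale)

end

lemma poly_mapping_add_induct [case_names zero single_add]:
  fixes f :: "'i \<Rightarrow>\<^sub>0 'g::monoid_add"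
  assumes "P 0" and "\<And>f n x. P f \<Longrightarrow> P (Poly_Mapping.single n x + f)"
  shows "P f"
proof (induction f rule: update_induct)
  case const
  then show ?case using assms(1) by simp
next
  case (update f n x)
  have "Poly_Mapping.update n x f = Poly_Mapping.single n x + f"
    by (rule poly_mapping_eqI)
      (use update in \<open>auto simp: lookup_update lookup_add lookup_single when_def in_keys_iff\<close>)
  then show ?case using assms(2) update by simp
qed

locale lie_algebra_with_form = lie_algebra sc brk
  for sc :: "complex \<Rightarrow> 'g::ab_group_add \<Rightarrow> 'g" and brk :: "'g \<Rightarrow> 'g \<Rightarrow> 'g" +
  fixes B :: "'g \<Rightarrow> 'g \<Rightarrow> complex"
  assumes inv: "invariant_form sc brk B"
begin

lemma B_add_left: "B (x + y) z = B x z + B y z"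
  by (rule inv[unfolded invariant_form_def, THEN conjunct1, rule_format])

lemma B_scale_left: "B (sc a x) y = a * B x y"
  by (rule inv[unfolded invariant_form_def, THEN conjunct2, THEN conjunct1, rule_format])

lemma B_sym: "B x y = B y x"
  by (rule inv[unfolded invariant_form_def, THEN conjunct2, THEN conjunct2, THEN conjunct1, rule_format])

lemma B_inv: "B (brk x y) z = B x (brk y z)"
  by (rule inv[unfolded invariant_form_def, THEN conjunct2, THEN conjunct2, THEN conjunct2, THEN conjunct1, rule_format])

lemma B_add_right: "B x (y + z) = B x y + B x z"
  using B_add_left[of y z x] by (simp only: B_sym[of x y] B_sym[of x z] B_sym[of x "y + z"])

lemma B_scale_right: "B x (sc a y) = a * B x y"
  using B_scale_left[of a y x] by (simp only: B_sym[of x y] B_sym[of x "sc a y"])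

lemma B_zero [simp]: "B 0 x = 0" "B x 0 = 0"
  using B_add_left[of 0 0 x] B_add_right[of x 0 0] by simp_all

lemma loop_cocycle_superset:
  fixes f g :: "(int ^ 'n::finite) \<Rightarrow>\<^sub>0 'g"
  assumes "finite S" "finite T" "Poly_Mapping.keys f \<subseteq> S" "Poly_Mapping.keys g \<subseteq> T"
  shows "loop_cocycle B f g =
     (\<chi> i. \<Sum>n\<in>S. \<Sum>m\<in>T. if n + m = 0
        then B (Poly_Mapping.lookup f n) (Poly_Mapping.lookup g m) * of_int (n $ i) else 0)"
proof -
  have 1: "(\<Sum>m\<in>T. if n + m = 0 then B x (Poly_Mapping.lookup g m) * of_int (n $ i) else 0) =
      (\<Sum>m\<in>Poly_Mapping.keys g. if n + m = 0 then B x (Poly_Mapping.lookup g m) * of_int (n $ i) else 0)"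
    for n :: "int ^ 'n" and x i
    by (rule sum.mono_neutral_right) (use assms in \<open>auto simp: in_keys_iff\<close>)
  show ?thesis
    unfolding loop_cocycle_def 1
    by (intro vec_eq_iff[THEN iffD2] allI, unfold vec_lambda_beta, rule sum.mono_neutral_left)
      (use assms in \<open>auto simp: in_keys_iff cong: if_cong\<close>)
qed

lemma if_add: "(if P then a + b else 0) = (if P then a else 0) + (if P then b else (0::complex))"
  by simp

lemma loop_cocycle_add_left:
  fixes f f' g :: "(int ^ 'n::finite) \<Rightarrow>\<^sub>0 'g"
  shows "loop_cocycle B (f + f') g = loop_cocycle B f g + loop_cocycle B f' g"
proof -
  define S where "S = Poly_Mapping.keys f \<union> Poly_Mapping.keys f'"
  have S: "finite S" "Poly_Mapping.keys f \<subseteq> S" "Poly_Mapping.keys f' \<subseteq> S"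
      "Poly_Mapping.keys (f + f') \<subseteq> S"
    using keys_add[of f f'] by (auto simp: S_def)
  show ?thesis
    by (rule vec_eq_iff[THEN iffD2])
      (use S in \<open>simp add: loop_cocycle_superset[where S = S and T = "Poly_Mapping.keys g"]
        lookup_add B_add_left distrib_right if_add sum.distrib cong: if_cong\<close>)
qed

lemma loop_cocycle_add_right:
  fixes f g g' :: "(int ^ 'n::finite) \<Rightarrow>\<^sub>0 'g"
  shows "loop_cocycle B f (g + g') = loop_cocycle B f g + loop_cocycle B f g'"
proof -
  define T where "T = Poly_Mapping.keys g \<union> Poly_Mapping.keys g'"
  have T: "finite T" "Poly_Mapping.keys g \<subseteq> T" "Poly_Mapping.keys g' \<subseteq> T"
      "Poly_Mapping.keys (g + g') \<subseteq> T"
    using keys_add[of g g'] by (auto simp: T_def)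
  show ?thesis
    by (rule vec_eq_iff[THEN iffD2])
      (use T in \<open>simp add: loop_cocycle_superset[where S = "Poly_Mapping.keys f" and T = T]
        lookup_add B_add_right distrib_right if_add sum.distrib cong: if_cong\<close>)
qed

lemma loop_cocycle_single [simp]:
  fixes n m :: "int ^ 'n::finite"
  shows "loop_cocycle B (Poly_Mapping.single n x) (Poly_Mapping.single m y) =
     (if n + m = 0 then B x y *s (\<chi> i. of_int (n $ i)) else 0)"
  by (rule vec_eq_iff[THEN iffD2], subst loop_cocycle_superset[of "{n}" "{m}"]) simp_all

lemma loop_cocycle_zero [simp]:
  fixes f :: "(int ^ 'n::finite) \<Rightarrow>\<^sub>0 'g"
  shows "loop_cocycle B 0 f = 0" "loop_cocycle B f 0 = 0"
  by (simp_all add: loop_cocycle_def vec_eq_iff)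

abbreviation tscale :: "complex \<Rightarrow> ('g, 'n::finite) toroidal \<Rightarrow> ('g, 'n) toroidal" where
  "tscale \<equiv> toroidal_scale sc"

abbreviation tbrk :: "'n::finite \<Rightarrow> ('g, 'n) toroidal \<Rightarrow> ('g, 'n) toroidal \<Rightarrow> ('g, 'n) toroidal" where
  "tbrk \<equiv> toroidal_bracket sc brk B"

lemma tbrk_pair:
  "tbrk l (f, c, a) (g, c', b) =
     (loop_bracket brk f g
        + loop_scale sc (\<lambda>n. a * of_int (n $ l)) g - loop_scale sc (\<lambda>n. b * of_int (n $ l)) f,
      loop_cocycle B f g, 0)"
  by (simp add: toroidal_bracket_def)

text \<open>The encoding satisfies the defining relations; \<open>lie_algebra_toroidal\<close> below shows that
  it is a Lie algebra.\<close>

lemma tbrk_loop_loop: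
  "tbrk l (loop x n) (loop y m) = loop (brk x y) (n + m) +
     (if n + m = 0 then tscale (B x y) (\<Sum>i\<in>UNIV. tscale (of_int (n $ i)) (centr i)) else 0)"
proof -
  have ts: "tscale a (0, c, 0) = (0, a *s c, 0)" for a and c :: "complex ^ 'a"
    by (simp add: toroidal_scale_def)
  have "(\<Sum>i\<in>I. (0, F i, 0)) = ((0, \<Sum>i\<in>I. F i, 0) :: ('g, 'a) toroidal)" if "finite I"
    for I :: "'a set" and F
    using that by (induction I) (auto simp: zero_prod_def)
  then have *: "(\<Sum>i\<in>UNIV. tscale (of_int (n $ i)) (centr i)) =
      ((0, \<chi> i. of_int (n $ i), 0) :: ('g, 'a) toroidal)"
    by (simp add: centr_def ts vec_eq_iff axis_def if_distrib sum.delta cong: if_cong)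
  show ?thesis
    unfolding * ts by (simp add: loop_def tbrk_pair zero_prod_def)
qed

lemma tbrk_centr: "tbrk l (centr i) X = 0" "tbrk l X (centr i) = 0"
  by (cases X; simp add: centr_def tbrk_pair zero_prod_def)+

lemma tbrk_deriv_loop: "tbrk l deriv_elt (loop x n) = tscale (of_int (n $ l)) (loop x n)"
  by (simp add: deriv_elt_def loop_def tbrk_pair toroidal_scale_def)

lemma tbrk_add_left: "tbrk l (X + Y) Z = tbrk l X Z + tbrk l Y Z"
  by (cases X; cases Y; cases Z)
    (simp add: tbrk_pair loop_bracket_add_left loop_cocycle_add_left loop_scale_add
      loop_scale_weight_add distrib_right)

lemma tbrk_add_right: "tbrk l X (Y + Z) = tbrk l X Y + tbrk l X Z"
  by (cases X; cases Y; cases Z)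
    (simp add: tbrk_pair loop_bracket_add_right loop_cocycle_add_right loop_scale_add
      loop_scale_weight_add distrib_right)

lemma vector_space_toroidal: "vector_space (tscale :: complex \<Rightarrow> ('g, 'n::finite) toroidal \<Rightarrow> _)"
  by unfold_locales
    (auto simp: toroidal_scale_def loop_scale_add loop_scale_weight_add loop_scale_loop_scale
      vec_eq_iff algebra_simps lookup_loop_scale intro!: poly_mapping_eqI)

lemma toroidal_induct [case_names loop central derivation add]:
  fixes X :: "('g, 'n::finite) toroidal"
  assumes "\<And>x n. P (loop x n)" "\<And>c. P (0, c, 0)" "\<And>a. P (0, 0, a)"
    and "\<And>X Y. P X \<Longrightarrow> P Y \<Longrightarrow> P (X + Y)"
  shows "P X"
proof -
  obtain f c a where X: "X = (f, c, a)" by (cases X)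
  have "P (f, 0, 0)"
  proof (induction f rule: poly_mapping_add_induct)
    case zero
    then show ?case by (rule assms(2))
  next
    case (single_add f n x)
    from assms(4)[OF assms(1)[of x n] this] show ?case by (simp add: loop_def)
  qed
  then have "P ((f, 0, 0) + (0, c, 0) + (0, 0, a))"
    by (intro assms)
  then show ?thesis by (simp add: X)
qed

lemma tbrk_swap: "tbrk l X Y = - tbrk l Y X"
proof (induction X rule: toroidal_induct)
  case (loop x n)
  show ?case
  proof (induction Y rule: toroidal_induct)
    case (loop y m)
    have "m = - n" if "n + m = 0"
      using that by (simp add: eq_neg_iff_add_eq_0 add.commute)
    then show ?case
      using brk_swap[of x y] B_sym[of x y]
      by (auto simp: loop_def tbrk_pair add.commute single_uminus vec_eq_iff)
  qed (simp_all add: loop_def tbrk_pair tbrk_add_left[unfolded loop_def] tbrk_add_right[unfolded loop_def])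
next
  case (central c)
  show ?case by (cases Y) (simp add: tbrk_pair zero_prod_def)
next
  case (derivation a)
  show ?case by (cases Y) (simp add: tbrk_pair)
next
  case (add X X')
  then show ?case by (simp add: tbrk_add_left tbrk_add_right)
qed

lemma tbrk_central [simp]: "tbrk l (0, c, 0) X = 0" "tbrk l X (0, c, 0) = 0"
  by (cases X; simp add: tbrk_pair zero_prod_def)+

lemma tbrk_zero [simp]: "tbrk l 0 X = 0" "tbrk l X 0 = 0"
  using tbrk_central[where c = 0] by (simp_all add: zero_prod_def)

lemma tbrk_derivation_loop:
  "tbrk l (0, 0, a) (loop x n) = loop (sc (a * of_int (n $ l)) x) n"
  "tbrk l (loop x n) (0, 0, a) = loop (sc (- a * of_int (n $ l)) x) n"
  by (simp_all add: loop_def tbrk_pair single_uminus)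

lemma tbrk_derivation_derivation: "tbrk l (0, 0, a) (0, 0, b) = 0"
  by (simp add: tbrk_pair zero_prod_def)

lemma tbrk_loop_loop':
  "tbrk l (loop x n) (loop y m) = loop (brk x y) (n + m) +
     (0, if n + m = 0 then B x y *s (\<chi> i. of_int (n $ i)) else 0, 0)"
  by (simp add: loop_def tbrk_pair)

lemma tbrk_jacobi_loops:
  fixes n m p :: "int ^ 'n::finite"
  shows "tbrk l (loop x n) (tbrk l (loop y m) (loop z p)) +
   tbrk l (loop y m) (tbrk l (loop z p) (loop x n)) +
   tbrk l (loop z p) (tbrk l (loop x n) (loop y m)) = 0"
proof -
  have "brk x (brk y z) + brk y (brk z x) + brk z (brk x y) = 0"
    by (rule jacobi)
  then have 1: "Poly_Mapping.single q (brk x (brk y z)) + Poly_Mapping.single q (brk y (brk z x))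
      + Poly_Mapping.single q (brk z (brk x y)) = 0" for q :: "int ^ 'n"
    by (simp only: single_add[symmetric]) simp
  have 2: "B y (brk z x) = B x (brk y z)" "B z (brk x y) = B x (brk y z)"
    using B_inv[of x y z] B_inv[of y z x] B_sym[of "brk x y" z] B_sym[of "brk y z" x]
    by simp_all
  have 3: "of_int (n $ i) + of_int (m $ i) + of_int (p $ i) = (0::complex)" if "n + (m + p) = 0" for i
  proof -
    have "n $ i + m $ i + p $ i = 0"
      using that by (metis add.assoc vector_add_component zero_index)
    then show ?thesis
      by (metis of_int_0 of_int_add)
  qed
  define q where "q = n + (m + p)"
  have q: "n + (m + p) = q" "m + (p + n) = q" "p + (n + m) = q"
    by (simp_all add: q_def ac_simps)
  define cc :: "int ^ 'n \<Rightarrow> complex ^ 'n" where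
    "cc = (\<lambda>n. if q = 0 then B x (brk y z) *s (\<chi> i. of_int (n $ i)) else 0)"
  have "tbrk l (loop x n) (tbrk l (loop y m) (loop z p)) = (Poly_Mapping.single q (brk x (brk y z)), cc n, 0)"
    unfolding tbrk_loop_loop' tbrk_add_right tbrk_central q cc_def by (simp add: loop_def)
  moreover have "tbrk l (loop y m) (tbrk l (loop z p) (loop x n)) = (Poly_Mapping.single q (brk y (brk z x)), cc m, 0)"
    unfolding tbrk_loop_loop' tbrk_add_right tbrk_central q 2 cc_def by (simp add: loop_def)
  moreover have "tbrk l (loop z p) (tbrk l (loop x n) (loop y m)) = (Poly_Mapping.single q (brk z (brk x y)), cc p, 0)"
    unfolding tbrk_loop_loop' tbrk_add_right tbrk_central q 2 cc_def by (simp add: loop_def)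
  moreover have "cc n + cc m + cc p = 0"
  proof (cases "q = 0")
    case True
    then have "B x (brk y z) * (of_int (n $ i) + of_int (m $ i) + of_int (p $ i)) = 0" for i
      using 3[of i] q(1) by simp
    then show ?thesis
      by (simp add: cc_def vec_eq_iff distrib_left)
  qed (simp add: cc_def)
  ultimately show ?thesis
    using 1[of q] by (simp add: zero_prod_def)
qed

lemma tbrk_jacobi_derivation_loops:
  fixes m p :: "int ^ 'n::finite"
  shows "tbrk l (0, 0, a) (tbrk l (loop y m) (loop z p)) +
   tbrk l (loop y m) (tbrk l (loop z p) (0, 0, a)) +
   tbrk l (loop z p) (tbrk l (0, 0, a) (loop y m)) = 0"
proof -
  define q where "q = m + p"
  have q: "m + p = q" "p + m = q"
    by (simp_all add: q_def ac_simps)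
  define b where "b = (if q = 0 then B y z else 0)"
  have "tbrk l (0, 0, a) (tbrk l (loop y m) (loop z p)) =
      (Poly_Mapping.single q (sc (a * of_int (q $ l)) (brk y z)), 0, 0)"
    unfolding tbrk_loop_loop' tbrk_add_right tbrk_central q tbrk_derivation_loop
    by (simp add: loop_def)
  moreover have "tbrk l (loop y m) (tbrk l (loop z p) (0, 0, a)) =
      (Poly_Mapping.single q (sc (- a * of_int (p $ l)) (brk y z)),
       (- a * of_int (p $ l) * b) *s (\<chi> i. of_int (m $ i)), 0)"
    unfolding tbrk_loop_loop' tbrk_derivation_loop q
    unfolding brk_scale_right B_scale_right by (simp add: loop_def b_def)
  moreover have "tbrk l (loop z p) (tbrk l (0, 0, a) (loop y m)) =
      (Poly_Mapping.single q (sc (- a * of_int (m $ l)) (brk y z)),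
       (a * of_int (m $ l) * b) *s (\<chi> i. of_int (p $ i)), 0)"
    unfolding tbrk_loop_loop' tbrk_derivation_loop q
    by (simp add: loop_def b_def brk_scale_right B_scale_right B_sym[of z y] brk_swap[of z y])
  moreover have "sc (a * of_int (q $ l)) (brk y z) + sc (- a * of_int (p $ l)) (brk y z)
      + sc (- a * of_int (m $ l)) (brk y z) = 0"
    unfolding scale_left_distrib[symmetric] by (simp add: q_def distrib_left)
  then have "Poly_Mapping.single q (sc (a * of_int (q $ l)) (brk y z))
      + Poly_Mapping.single q (sc (- a * of_int (p $ l)) (brk y z))
      + Poly_Mapping.single q (sc (- a * of_int (m $ l)) (brk y z)) = 0"
    by (simp only: single_add[symmetric]) simp
  moreover have "(- a * of_int (p $ l) * b) *s (\<chi> i. of_int (m $ i))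
      + (a * of_int (m $ l) * b) *s (\<chi> i. of_int (p $ i)) = 0"
  proof (cases "q = 0")
    case True
    then have "p = - m"
      by (simp add: q_def eq_neg_iff_add_eq_0 add.commute)
    then show ?thesis
      by (simp add: vec_eq_iff)
  next
    case False
    then have "b = 0" by (simp add: b_def)
    then show ?thesis by simp
  qed
  ultimately show ?thesis
    by (simp add: zero_prod_def)
qed

abbreviation jac :: "'n::finite \<Rightarrow> ('g, 'n) toroidal \<Rightarrow> ('g, 'n) toroidal \<Rightarrow> ('g, 'n) toroidal \<Rightarrow> ('g, 'n) toroidal"
  where "jac l X Y Z \<equiv> tbrk l X (tbrk l Y Z) + tbrk l Y (tbrk l Z X) + tbrk l Z (tbrk l X Y)"

lemma jac_cycle: "jac l X Y Z = jac l Y Z X"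
  by (simp only: ac_simps)

lemma jac_add: "jac l (X + X') Y Z = jac l X Y Z + jac l X' Y Z"
  by (simp only: tbrk_add_left tbrk_add_right ac_simps)

lemma jac_zero_step: "jac l X Y Z = 0 \<Longrightarrow> jac l X' Y Z = 0 \<Longrightarrow> jac l (X + X') Y Z = 0"
  by (simp only: jac_add) simp

lemma jac_central: "jac l (0, c, 0) Y Z = 0"
  by simp

lemma jac_derivation_derivation: "jac l (0, 0, a) (0, 0, b) Z = 0"
  by (cases Z) (simp add: tbrk_pair loop_scale_loop_scale lookup_loop_scale zero_prod_def
      poly_mapping_eq_iff fun_eq_iff lookup_add lookup_minus ac_simps)

lemma jac_derivation: "jac l (0, 0, a) Y Z = 0"
proof (induction Y rule: toroidal_induct)
  case (loop y m)
  have "jac l Z (0, 0, a) (loop y m) = 0"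
  proof (induction Z rule: toroidal_induct)
    case (loop z p)
    show ?case using tbrk_jacobi_derivation_loops jac_cycle by metis
  next
    case (derivation b)
    show ?case by (rule jac_derivation_derivation)
  qed (rule jac_central jac_zero_step; assumption?)+
  then show ?case using jac_cycle by metis
next
  case (central c)
  show ?case using jac_central jac_cycle by metis
next
  case (derivation b)
  show ?case by (rule jac_derivation_derivation)
next
  case (add Y Y')
  then show ?case using jac_zero_step jac_cycle by metis
qed

lemma jac_zero: "jac l X Y Z = 0"
proof (induction X rule: toroidal_induct)
  case (loop x n)
  have "jac l Y Z (loop x n) = 0"
  proof (induction Y rule: toroidal_induct)
    case (loop y m)
    have "jac l Z (loop x n) (loop y m) = 0"
    proof (induction Z rule: toroidal_induct)
      case (loop z p)
      show ?case by (rule tbrk_jacobi_loops)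
    qed (rule jac_central jac_derivation jac_zero_step; assumption?)+
    then show ?case using jac_cycle by metis
  qed (rule jac_central jac_derivation jac_zero_step; assumption?)+
  then show ?case using jac_cycle by metis
qed (rule jac_central jac_derivation jac_zero_step; assumption?)+

lemma tbrk_scale_left: "tbrk l (tscale a X) Y = tscale a (tbrk l X Y)"
proof (induction X rule: toroidal_induct)
  case (loop x n)
  show ?case
  proof (induction Y rule: toroidal_induct)
    case (loop y m)
    show ?case
      by (simp add: loop_def tbrk_pair toroidal_scale_def brk_scale_left B_scale_left vec_eq_iff)
  next
    case (central c)
    show ?case by (simp add: toroidal_scale_def zero_prod_def)
  next
    case (derivation b)
    show ?case by (simp add: loop_def tbrk_pair toroidal_scale_def loop_scale_minus single_uminus ac_simps)
  next
    case (add Y Y')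
    then show ?case
      by (simp add: tbrk_add_right vector_space.vector_space_assms(1)[OF vector_space_toroidal])
  qed
next
  case (central c)
  show ?case by (simp add: toroidal_scale_def zero_prod_def)
next
  case (derivation b)
  show ?case by (cases Y) (simp add: tbrk_pair toroidal_scale_def loop_scale_loop_scale ac_simps)
next
  case (add X X')
  then show ?case
    by (simp add: tbrk_add_left vector_space.vector_space_assms(1)[OF vector_space_toroidal])
qed

theorem lie_algebra_toroidal: "lie_algebra (tscale :: complex \<Rightarrow> ('g, 'n::finite) toroidal \<Rightarrow> _) (tbrk l)"
proof -
  interpret T: vector_space "tscale :: complex \<Rightarrow> ('g, 'n::finite) toroidal \<Rightarrow> _"
    by (rule vector_space_toroidal)
  show ?thesis
  proof unfold_locales
    fix X Y Z :: "('g, 'n) toroidal" and a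
    show "tbrk l X (tscale a Y) = tscale a (tbrk l X Y)"
      by (subst (1 2) tbrk_swap) (simp add: tbrk_scale_left T.scale_minus_right)
    have "tscale 2 (tbrk l X X) = 0"
      using tbrk_swap[of l X X] T.scale_left_distrib[of 1 1 "tbrk l X X"]
      by (simp add: eq_neg_iff_add_eq_0)
    then show "tbrk l X X = 0"
      by simp
    show "jac l X Y Z = 0"
      by (rule jac_zero)
  qed (simp_all add: tbrk_add_left tbrk_add_right tbrk_scale_left)
qed

end

section \<open>The Sugawara operator\<close>

definition normal_ordered ::
    "(('g::ab_group_add, 'k::finite) toroidal \<Rightarrow> 'v \<Rightarrow> 'v) \<Rightarrow> 'k \<Rightarrow> 'g \<Rightarrow> 'g \<Rightarrow> int \<Rightarrow> 'v \<Rightarrow> 'v" where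
  "normal_ordered act l x y d v =
     (if d \<ge> 0 then act (loop x (axis l (- d))) (act (loop y (axis l d)) v)
      else act (loop y (axis l d)) (act (loop x (axis l (- d))) v))"

text \<open>\<^const>\<open>Sum_any\<close> is the sum over all integers of a family with finite support; the support
  is finite on the modules considered here, see the final lemma.\<close>

definition sugawara ::
    "(complex \<Rightarrow> 'v::ab_group_add \<Rightarrow> 'v) \<Rightarrow> (('g::ab_group_add, 'k::finite) toroidal \<Rightarrow> 'v \<Rightarrow> 'v) \<Rightarrow> 'k \<Rightarrow>
      ('j::finite \<Rightarrow> 'g) \<Rightarrow> ('j \<Rightarrow> 'g) \<Rightarrow> 'v \<Rightarrow> 'v" where
  "sugawara scaleV act l e e' v =
     scaleV (1/2) (\<Sum>j\<in>UNIV. Sum_any (\<lambda>d. normal_ordered act l (e j) (e' j) d v))"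

lemma (in lie_algebra_with_form) loop_eventually_zero:
  fixes l :: "'n::finite" and act :: "('g, 'n) toroidal \<Rightarrow> 'v::ab_group_add \<Rightarrow> 'v"
  assumes "lie_module tscale (tbrk l) scaleV act"
    and diag: "diagonalizable scaleV (act deriv_elt)"
    and bound: "real_eigenvalues_bounded_above scaleV (act deriv_elt)"
  shows "\<exists>N. \<forall>x n. n $ l > N \<longrightarrow> act (loop x n) v = 0"
proof -
  interpret lie_module tscale "tbrk l" scaleV act by fact
  from bound obtain M where M: "eigenvalue scaleV (act deriv_elt) a \<Longrightarrow> Re a \<le> M" for a
    unfolding real_eigenvalues_bounded_above_def by blast
  have act_zero: "act X 0 = 0" for X
    using act_add_right[of X 0 0] by simp
  have "v \<in> V.span {v. \<exists>a. act deriv_elt v = scaleV a v}"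
    using diag by (simp add: diagonalizable_def)
  then show ?thesis
  proof (induction v rule: V.span_induct_alt)
    case base
    then show ?case by (simp add: act_zero)
  next
    case (step c v w)
    then obtain a N where a: "act deriv_elt v = scaleV a v"
      and N: "\<And>x n. n $ l > N \<Longrightarrow> act (loop x n) w = 0"
      by blast
    have "act (loop x n) v = 0" if n: "n $ l > \<lceil>M - Re a\<rceil>" for x n
    proof (rule ccontr)
      assume nz: "act (loop x n) v \<noteq> 0"
      have "scaleV (of_int (n $ l)) (act (loop x n) v) =
          act deriv_elt (act (loop x n) v) - act (loop x n) (act deriv_elt v)"
        using act_brk[of deriv_elt "loop x n" v]
        unfolding tbrk_deriv_loop act_scale_left .
      then have "act deriv_elt (act (loop x n) v) = scaleV (of_int (n $ l) + a) (act (loop x n) v)"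
        by (simp add: a act_scale_right V.scale_left_distrib)
      then have "eigenvalue scaleV (act deriv_elt) (of_int (n $ l) + a)"
        using nz unfolding eigenvalue_def by blast
      from M[OF this] have "of_int (n $ l) \<le> M - Re a"
        by simp
      with n show False
        by linarith
    qed
    then have "n $ l > max N \<lceil>M - Re a\<rceil> \<Longrightarrow> act (loop x n) (scaleV c v + w) = 0" for x n
      by (simp add: act_add_right act_scale_right N)
    then show ?case by blast
  qed
qed

lemma (in lie_algebra_with_form) finite_normal_ordered:
  fixes l :: "'n::finite" and act :: "('g, 'n) toroidal \<Rightarrow> 'v::ab_group_add \<Rightarrow> 'v"
  assumes mod: "lie_module tscale (tbrk l) scaleV act"
    and "diagonalizable scaleV (act deriv_elt)"
    and "real_eigenvalues_bounded_above scaleV (act deriv_elt)"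
  shows "finite {d. normal_ordered act l x y d v \<noteq> 0}"
proof -
  interpret lie_module tscale "tbrk l" scaleV act by fact
  obtain N where N: "\<And>x n. n $ l > N \<Longrightarrow> act (loop x n) v = 0"
    using loop_eventually_zero[OF assms, of v] by blast
  have act_zero: "act X 0 = 0" for X
    using act_add_right[of X 0 0] by simp
  have "\<bar>d\<bar> \<le> \<bar>N\<bar>" if "normal_ordered act l x y d v \<noteq> 0" for d
    using that N[of "axis l d" y] N[of "axis l (- d)" x]
    by (cases "d > N"; cases "- d > N") (auto simp: normal_ordered_def act_zero split: if_splits)
  then have "{d. normal_ordered act l x y d v \<noteq> 0} \<subseteq> {- \<bar>N\<bar>..\<bar>N\<bar>}"
    by (auto simp: abs_le_iff minus_le_iff)
  then show ?thesis
    using finite_subset by blast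
qed

end

theory Submission
  imports Defs
begin

text \<open>The commutator is computed mode by mode. For \<open>d \<ge> 0\<close> let \<open>S\<^sub>d\<close> be the sum over \<open>j\<close> of
\<open>e\<^sub>j(-d) \<cdot> e\<^sup>j(d)\<close>. The tensor \<open>\<Sum>\<^sub>j e\<^sub>j \<otimes> e\<^sup>j\<close> is symmetric, so both modes \<open>d\<close> and \<open>-d\<close> of the
normally ordered sum give \<open>S\<^sub>d\<close>, and the Sugawara operator is half the sum of \<open>S\<close> at \<open>\<bar>d\<bar>\<close> over all
integers \<open>d\<close>. Put \<open>N = n\<^sub>k\<close> and

  \<open>A(p) = \<Sum>\<^sub>j e\<^sub>j(n' + p) \<cdot> [x, e\<^sup>j](N - p)\<close>,  \<open>C(p) = \<Sum>\<^sub>j e\<^sub>j(p) \<cdot> [x, e\<^sup>j](n - p)\<close>.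

Because \<open>n' \<noteq> 0\<close>, commuting \<open>x(n)\<close> past a mode in the direction \<open>k\<close> never meets the cocycle, and
invariance of the tensor turns the commutator with \<open>S\<^sub>d\<close> into \<open>- A(N - d) + C(- d)\<close>
(\<open>commutator_mode_pair\<close>). With the step function that takes the value \<open>1\<close> on negative integers,
\<open>1/2\<close> at \<open>0\<close> and \<open>0\<close> on positive integers, the whole commutator becomes a sum of \<open>- A\<close> cut off at
\<open>N\<close> plus a sum of \<open>C\<close> cut off at \<open>0\<close>, where a cut counts its end point with weight \<open>1/2\<close>. The
asserted formula has both cuts at \<open>N/2\<close>.

Moving the cuts costs a finite combination of the \<open>A(p)\<close> and \<open>C(p)\<close>, and the reflection
\<open>p \<mapsto> N - p\<close>, which fixes \<open>N/2\<close>, pairs \<open>A(p)\<close> with \<open>C(N - p)\<close>. Interchanging the two factors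
of \<open>A(p)\<close> gives \<open>A(p) + C(N - p) = - \<Omega>(x)(n)\<close>, where \<open>\<Omega>\<close> is the Casimir operator in the adjoint
representation (\<open>shifted_add_unshifted\<close>); again no central term appears, as \<open>n \<noteq> 0\<close>. The total weight
of the moved terms is \<open>N/2\<close> and \<open>\<Omega>\<close> is multiplication by \<open>2 h\<^sup>\<or>\<close>, which leaves \<open>h\<^sup>\<or> N x(n)\<close>.

That \<open>\<Omega> = 2 h\<^sup>\<or>\<close> (\<open>casimir_eq\<close>) needs some structure theory. The operator \<open>\<Omega>\<close> commutes with the
adjoint action, so its eigenspaces are ideals and, by simplicity, one eigenvector determines it. A highest
root vector \<open>z\<close> is one. Root spaces turn out to be one-dimensional, so choose \<open>x\<^sub>\<alpha>\<close> and \<open>y\<^sub>\<alpha>\<close> spanning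
the spaces of \<open>\<alpha>\<close> and \<open>-\<alpha>\<close> with \<open>\<langle>x\<^sub>\<alpha>, y\<^sub>\<alpha>\<rangle> = 1\<close>; then \<open>[x\<^sub>\<alpha>, y\<^sub>\<alpha>]\<close> is the element \<open>t\<^sub>\<alpha>\<close> of the Cartan
subalgebra that represents \<open>\<alpha>\<close>, and every \<open>v\<close> is \<open>\<Sum>\<^sub>\<alpha> \<langle>v, y\<^sub>\<alpha>\<rangle> x\<^sub>\<alpha>\<close> plus an element of the Cartan subalgebra.
Expanding the second factor of \<open>\<Omega> z\<close> in this way, the Cartan part contributes \<open>\<langle>\<theta>, \<theta>\<rangle> z = 2 z\<close>,
a positive \<open>\<alpha>\<close> contributes nothing because \<open>\<theta>\<close> is highest, and \<open>-\<alpha>\<close> contributes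
\<open>[t\<^sub>\<alpha>, z] = \<langle>\<alpha>, \<theta>\<rangle> z\<close>. The sum is \<open>2 (1 + \<langle>\<rho>, \<theta>\<rangle>) z = 2 h\<^sup>\<or> z\<close>.

Both facts about root spaces that are not formal, \<open>\<langle>\<alpha>, \<alpha>\<rangle> \<noteq> 0\<close> and one-dimensionality, follow from
one observation: a vector killed by \<open>x\<close> on which the powers of \<open>y\<close> can be undone by \<open>x\<close> generates
infinitely many weights (\<open>no_infinite_ladder\<close>).\<close>

section \<open>Eigenvectors of commuting operators\<close>

context vector_space
begin

text \<open>Indexing the components by their eigenvalues makes the eigenvalues distinct, which the
next lemma exploits.\<close>

lemma span_eigenvectors_sum:
  assumes "v \<in> span {v. \<exists>a. T v = scale a v}" and T: "Vector_Spaces.linear scale scale T"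
  shows "\<exists>I f. finite I \<and> (\<forall>a. T (f a) = scale a (f a)) \<and> v = (\<Sum>a\<in>I. f a)"
proof -
  interpret T: Vector_Spaces.linear scale scale T by (rule T)
  \<comment> \<open>Vanishing of \<open>f\<close> off \<open>I\<close> lets a new eigenvalue be merged with an old one without a case distinction.\<close>
  have "\<exists>I f. finite I \<and> (\<forall>a. T (f a) = scale a (f a)) \<and> (\<forall>a. a \<notin> I \<longrightarrow> f a = 0) \<and> v = (\<Sum>a\<in>I. f a)"
    using assms(1)
  proof (induction v rule: span_induct_alt)
    case base
    show ?case by (rule exI[of _ "{}"], rule exI[of _ "\<lambda>_. 0"]) (simp add: T.zero)
  next
    case (step c w v)
    then obtain I f where f: "finite I" "\<And>a. T (f a) = scale a (f a)" "\<And>a. a \<notin> I \<Longrightarrow> f a = 0"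
      "v = (\<Sum>a\<in>I. f a)" by blast
    from step obtain b where b: "T w = scale b w" by blast
    define g where "g = f(b := f b + scale c w)"
    have "(\<Sum>a\<in>insert b I. g a) = g b + (\<Sum>a\<in>I - {b}. g a)"
      using f(1) by (simp add: sum.insert_remove)
    also have "(\<Sum>a\<in>I - {b}. g a) = (\<Sum>a\<in>I - {b}. f a)"
      by (rule sum.cong) (auto simp: g_def)
    also have "g b + \<dots> = scale c w + (\<Sum>a\<in>insert b I. f a)"
      using f(1) by (simp add: sum.insert_remove g_def)
    also have "(\<Sum>a\<in>insert b I. f a) = v"
      using f by (cases "b \<in> I") (simp_all add: insert_absorb)
    finally have "scale c w + v = (\<Sum>a\<in>insert b I. g a)" ..
    moreover have "T (g a) = scale a (g a)" for a
      by (simp add: g_def f T.add T.scale b scale_right_distrib mult.commute)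
    moreover have "g a = 0" if "a \<notin> insert b I" for a
      using that f(3) by (simp add: g_def)
    ultimately show ?case
      using f(1) by (intro exI[of _ "insert b I"] exI[of _ g]) blast
  qed
  then show ?thesis by blast
qed

text \<open>Applying \<open>T - c\<close> kills the component with eigenvalue \<open>c\<close> and
rescales the others by nonzero factors, so the claim follows by induction on the number
of components.\<close>

lemma eigencomponents_in_invariant_subspace:
  assumes "finite I" "subspace W" "\<And>w. w \<in> W \<Longrightarrow> T w \<in> W"
    and T: "Vector_Spaces.linear scale scale T"
    and "\<And>a. T (f a) = scale a (f a)" "(\<Sum>a\<in>I. f a) \<in> W" "b \<in> I"
  shows "f b \<in> W"
  using assms(1,5-)
proof (induction I arbitrary: f b rule: finite_induct)
  case (insert c I)
  interpret T: Vector_Spaces.linear scale scale T by (rule T)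
  define g where "g a = scale (a - c) (f a)" for a
  have "(\<Sum>a\<in>I. g a) = T (\<Sum>a\<in>insert c I. f a) - scale c (\<Sum>a\<in>insert c I. f a)"
    using insert.hyps
    by (simp add: T.add T.sum insert.prems(1) g_def scale_left_diff_distrib sum_subtractf
        scale_right_distrib scale_sum_right)
  also have "\<dots> \<in> W"
    using insert.prems(2) by (intro subspace_diff subspace_scale assms(2,3))
  finally have sumg: "(\<Sum>a\<in>I. g a) \<in> W" .
  have "T (g a) = scale a (g a)" for a
    by (simp add: g_def T.scale insert.prems(1) mult.commute)
  then have "g a \<in> W" if "a \<in> I" for a
    using insert.IH[of g a] sumg that by blast
  then have f: "f a \<in> W" if "a \<in> I" for a
  proof -
    have "scale (inverse (a - c)) (g a) \<in> W"
      using that \<open>\<And>a. a \<in> I \<Longrightarrow> g a \<in> W\<close> by (intro subspace_scale assms(2))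
    moreover have "a \<noteq> c" using that insert.hyps by auto
    ultimately show ?thesis by (simp add: g_def)
  qed
  have "(\<Sum>a\<in>insert c I. f a) - (\<Sum>a\<in>I. f a) \<in> W"
    using subspace_diff[OF assms(2) insert.prems(2) subspace_sum[OF assms(2)]] f by blast
  then have "f c \<in> W"
    using insert.hyps by simp
  with f insert.prems(3) show ?case by auto
qed simp

end

section \<open>Dual bases\<close>

locale lie_algebra_with_dual_bases = lie_algebra_with_form sc brk B
  for sc :: "complex \<Rightarrow> 'g::ab_group_add \<Rightarrow> 'g" and brk and B +
  fixes e e' :: "'j::finite \<Rightarrow> 'g"
  assumes dual: "dual_bases sc B e e'"

context lie_algebra_with_form
begin

lemma B_nondegenerate: "(\<And>y. B x y = 0) \<Longrightarrow> x = 0"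
  using inv unfolding invariant_form_def by blast

lemma linear_B_left: "Vector_Spaces.linear sc (*) (\<lambda>x. B x y)"
  by unfold_locales (simp_all add: B_add_left B_scale_left algebra_simps)

lemma B_sum_left: "B (\<Sum>i\<in>I. f i) y = (\<Sum>i\<in>I. B (f i) y)"
proof -
  interpret Vector_Spaces.linear sc "(*)" "\<lambda>x. B x y" by (rule linear_B_left)
  show ?thesis by (rule sum)
qed

lemma B_sum_right: "B x (\<Sum>i\<in>I. f i) = (\<Sum>i\<in>I. B x (f i))"
  by (simp add: B_sym[of x] B_sum_left)

lemma B_diff_left: "B (x - y) z = B x z - B y z"
  using B_add_left[of "x - y" y z] by simp

lemma B_minus_left: "B (- x) y = - B x y"
  using B_diff_left[of 0 x y] by simp

lemma B_minus_right: "B x (- y) = - B x y"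
  by (simp add: B_sym[of x] B_minus_left)

lemma B_diff_right: "B x (y - z) = B x y - B x z"
  by (simp add: B_sym[of x] B_diff_left)

lemma B_brk_left: "B (brk z x) y = - B x (brk z y)"
  by (subst brk_swap) (simp add: B_minus_left B_inv)

end

context lie_algebra
begin

lemma linear_brk_left: "Vector_Spaces.linear sc sc (\<lambda>x. brk x y)"
  by unfold_locales (simp_all add: brk_add_left brk_scale_left algebra_simps)

lemma linear_brk_right: "Vector_Spaces.linear sc sc (brk x)"
  by unfold_locales (simp_all add: brk_add_right brk_scale_right algebra_simps)

lemma brk_sum_right: "brk x (\<Sum>i\<in>I. f i) = (\<Sum>i\<in>I. brk x (f i))"
proof -
  interpret Vector_Spaces.linear sc sc "brk x" by (rule linear_brk_right)
  show ?thesis by (rule sum)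
qed

lemma brk_sum_left: "brk (\<Sum>i\<in>I. f i) y = (\<Sum>i\<in>I. brk (f i) y)"
proof -
  interpret Vector_Spaces.linear sc sc "\<lambda>x. brk x y" by (rule linear_brk_left)
  show ?thesis by (rule sum)
qed

lemma brk_diff_right: "brk x (y - z) = brk x y - brk x z"
  using brk_add_right[of x "y - z" z] by simp

lemma brk_diff_left: "brk (x - y) z = brk x z - brk y z"
  using brk_add_left[of "x - y" y z] by simp

lemma brk_minus_left: "brk (- x) y = - brk x y"
  using brk_diff_left[of 0 x y] by simp

lemma brk_minus_right: "brk x (- y) = - brk x y"
  using brk_diff_right[of x 0 y] by simp

lemma brk_brk_right: "brk z (brk x y) = brk (brk z x) y + brk x (brk z y)"
  using jacobi[of z x y] brk_swap[of "brk z x" y] brk_swap[of y z] 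
  by (simp add: brk_minus_right algebra_simps)

end

text \<open>A tensor such as \<open>\<Sum>\<^sub>j e\<^sub>j \<otimes> e\<^sup>j\<close> is
represented by its images under all bilinear maps, and identities between tensors become
identities for an arbitrary such map.\<close>

definition bilinear_map ::
    "(complex \<Rightarrow> 'g::ab_group_add \<Rightarrow> 'g) \<Rightarrow> (complex \<Rightarrow> 'v::ab_group_add \<Rightarrow> 'v) \<Rightarrow> ('g \<Rightarrow> 'g \<Rightarrow> 'v) \<Rightarrow> bool"
  where "bilinear_map s t F \<longleftrightarrow>
    (\<forall>x. Vector_Spaces.linear s t (F x)) \<and> (\<forall>y. Vector_Spaces.linear s t (\<lambda>x. F x y))"

lemma bilinear_map_left_sum:
  assumes "bilinear_map s t F"
  shows "F (\<Sum>i\<in>I. s (c i) (f i)) y = (\<Sum>i\<in>I. t (c i) (F (f i) y))"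
proof -
  interpret Vector_Spaces.linear s t "\<lambda>x. F x y"
    using assms unfolding bilinear_map_def by blast
  show ?thesis by (simp add: sum scale)
qed

lemma bilinear_map_right_sum:
  assumes "bilinear_map s t F"
  shows "F x (\<Sum>i\<in>I. s (c i) (f i)) = (\<Sum>i\<in>I. t (c i) (F x (f i)))"
proof -
  interpret Vector_Spaces.linear s t "F x"
    using assms unfolding bilinear_map_def by blast
  show ?thesis by (simp add: sum scale)
qed

context lie_algebra_with_dual_bases
begin

lemma basis_expansion: "(\<Sum>j\<in>UNIV. sc (B v (e' j)) (e j)) = v"
proof -
  have "v \<in> span (range e)"
    using dual by (simp add: dual_bases_def)
  then show ?thesis
  proof (induction v rule: span_induct_alt)
    case (step c w v)
    then obtain i where w: "w = e i" by blast
    have "B (sc c w + v) (e' j) = c * (if i = j then 1 else 0) + B v (e' j)" for j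
      using dual by (simp add: w B_add_left B_scale_left dual_bases_def)
    then have "(\<Sum>j\<in>UNIV. sc (B (sc c w + v) (e' j)) (e j)) =
        (\<Sum>j\<in>UNIV. (if i = j then sc c (e j) else 0) + sc (B v (e' j)) (e j))"
      by (intro sum.cong) (simp_all add: scale_left_distrib)
    then show ?case
      by (simp add: sum.distrib step.IH w)
  qed simp
qed

lemma dual_basis_expansion: "(\<Sum>j\<in>UNIV. sc (B v (e j)) (e' j)) = v"
proof -
  define w where "w = (\<Sum>j\<in>UNIV. sc (B v (e j)) (e' j)) - v"
  have "B w (e i) = 0" for i
  proof -
    have "B v (e j) * B (e' j) (e i) = (if i = j then B v (e j) else 0)" for j
      using dual by (subst B_sym[of "e' j"]) (simp add: dual_bases_def)
    then show ?thesis
      by (simp add: w_def B_diff_left B_sum_left B_scale_left)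
  qed
  then have "B w u = 0" for u
    using basis_expansion[of u] B_sum_right[of w "\<lambda>j. sc (B u (e' j)) (e j)" UNIV]
    by (simp add: B_scale_right)
  then have "w = 0"
    by (rule B_nondegenerate)
  then show ?thesis by (simp add: w_def)
qed

text \<open>The tensor of dual bases corresponds to the identity operator under the identification
of \<open>\<gg> \<otimes> \<gg>\<close> with the endomorphisms; applying
\<open>S\<close> to the first factor or its adjoint to the second both give the tensor
of \<open>S\<close>.\<close>

lemma sum_dual_bases_adjoint:
  assumes F: "bilinear_map sc t F"
    and adj: "\<And>x y. B (S x) y = B x (T y)"
  shows "(\<Sum>j\<in>UNIV. F (S (e j)) (e' j)) = (\<Sum>j\<in>UNIV. F (e j) (T (e' j)))"
proof -
  have "F (S (e j)) (e' j) = (\<Sum>i\<in>UNIV. t (B (T (e' i)) (e j)) (F (e i) (e' j)))" for j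
  proof -
    have "F (S (e j)) (e' j) = F (\<Sum>i\<in>UNIV. sc (B (S (e j)) (e' i)) (e i)) (e' j)"
      by (simp only: basis_expansion)
    also have "\<dots> = (\<Sum>i\<in>UNIV. t (B (S (e j)) (e' i)) (F (e i) (e' j)))"
      by (rule bilinear_map_left_sum[OF F])
    finally show ?thesis
      by (simp only: adj B_sym[of "e j"])
  qed
  then have "(\<Sum>j\<in>UNIV. F (S (e j)) (e' j)) =
      (\<Sum>j\<in>UNIV. \<Sum>i\<in>UNIV. t (B (T (e' i)) (e j)) (F (e i) (e' j)))"
    by (intro sum.cong refl)
  also have "\<dots> = (\<Sum>i\<in>UNIV. \<Sum>j\<in>UNIV. t (B (T (e' i)) (e j)) (F (e i) (e' j)))"
    by (rule sum.swap)
  also have "\<dots> = (\<Sum>i\<in>UNIV. F (e i) (T (e' i)))"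
    by (simp flip: bilinear_map_right_sum[OF F] add: dual_basis_expansion)
  finally show ?thesis .
qed

text \<open>Invariance of the form says that \<open>- ad x\<close> is the adjoint of \<open>ad
x\<close>.\<close>

lemma sum_dual_bases_brk:
  assumes "bilinear_map sc t F"
  shows "(\<Sum>j\<in>UNIV. F (brk x (e j)) (e' j)) = - (\<Sum>j\<in>UNIV. F (e j) (brk x (e' j)))"
proof -
  have "F u (- w) = - F u w" for u w
  proof -
    interpret Vector_Spaces.linear sc t "F u"
      using assms unfolding bilinear_map_def by blast
    show ?thesis by (rule neg)
  qed
  then show ?thesis
    using sum_dual_bases_adjoint[OF assms, of "brk x" "\<lambda>y. - brk x y"]
    by (simp add: B_brk_left B_minus_right sum_negf)
qed

text \<open>Symmetry of the tensor reflects symmetry of the form.\<close>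

lemma sum_dual_bases_swap:
  assumes F: "bilinear_map sc t F"
  shows "(\<Sum>j\<in>UNIV. F (e j) (e' j)) = (\<Sum>j\<in>UNIV. F (e' j) (e j))"
proof -
  have "F (e j) (e' j) = (\<Sum>i\<in>UNIV. t (B (e i) (e j)) (F (e' i) (e' j)))" for j
  proof -
    have "F (e j) (e' j) = F (\<Sum>i\<in>UNIV. sc (B (e j) (e i)) (e' i)) (e' j)"
      by (simp only: dual_basis_expansion)
    also have "\<dots> = (\<Sum>i\<in>UNIV. t (B (e j) (e i)) (F (e' i) (e' j)))"
      by (rule bilinear_map_left_sum[OF F])
    finally show ?thesis
      by (simp only: B_sym[of "e j"])
  qed
  then have "(\<Sum>j\<in>UNIV. F (e j) (e' j)) =
      (\<Sum>j\<in>UNIV. \<Sum>i\<in>UNIV. t (B (e i) (e j)) (F (e' i) (e' j)))"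
    by (intro sum.cong refl)
  also have "\<dots> = (\<Sum>i\<in>UNIV. \<Sum>j\<in>UNIV. t (B (e i) (e j)) (F (e' i) (e' j)))"
    by (rule sum.swap)
  also have "\<dots> = (\<Sum>i\<in>UNIV. F (e' i) (e i))"
    by (simp flip: bilinear_map_right_sum[OF F] add: dual_basis_expansion)
  finally show ?thesis .
qed

definition casimir :: "'g \<Rightarrow> 'g" where
  "casimir x = (\<Sum>j\<in>UNIV. brk (e j) (brk (e' j) x))"

lemma bilinear_casimir: "bilinear_map sc sc (\<lambda>a b. brk a (brk b x))"
  unfolding bilinear_map_def
  by (intro conjI allI; unfold_locales)
    (simp_all add: brk_add_left brk_scale_left brk_add_right brk_scale_right algebra_simps)

text \<open>The derivation \<open>ad z\<close> acts on both factors of the invariant tensor, where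
its contributions cancel, and on the argument.\<close>

lemma brk_casimir: "brk z (casimir x) = casimir (brk z x)"
proof -
  have "brk z (brk a (brk b x)) = brk (brk z a) (brk b x) + brk a (brk (brk z b) x) + brk a (brk b (brk z x))"
    for a b
    by (simp only: brk_brk_right[of z a] brk_brk_right[of z b] brk_add_right add.assoc)
  then have "brk z (casimir x) = (\<Sum>j\<in>UNIV. brk (brk z (e j)) (brk (e' j) x))
      + (\<Sum>j\<in>UNIV. brk (e j) (brk (brk z (e' j)) x)) + casimir (brk z x)"
    unfolding casimir_def brk_sum_right sum.distrib[symmetric]
    by (intro sum.cong refl)
  then show ?thesis
    using sum_dual_bases_brk[OF bilinear_casimir, of z x] by simp
qed

lemma linear_casimir: "Vector_Spaces.linear sc sc casimir"
  by unfold_locales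
    (simp_all add: casimir_def brk_add_right brk_scale_right sum.distrib scale_sum_right
      scale_right_distrib scale_left_distrib)

end

section \<open>Root spaces\<close>

locale cartan_decomposition =
  simple_lie_algebra sc brk + lie_algebra_with_form sc brk B
  for sc :: "complex \<Rightarrow> 'g::ab_group_add \<Rightarrow> 'g" and brk and B +
  fixes H :: "'g set"
  assumes cartan: "cartan_subalgebra sc brk H"
begin

text \<open>Only the values of \<open>\<mu>\<close> on \<open>H\<close> matter, so pointwise sums
and multiples of weights can be used as they stand; membership in \<open>Phi\<close>
fixes the remaining values to \<open>0\<close>.\<close>

definition weight_space :: "('g \<Rightarrow> complex) \<Rightarrow> 'g set" where
  "weight_space \<mu> = {x. \<forall>h\<in>H. brk h x = sc (\<mu> h) x}"

text \<open>The element \<open>t\<^sub>\<alpha>\<close> of \<open>H\<close> that represents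
\<open>\<alpha>\<close> with respect to the form.\<close>

definition t :: "('g \<Rightarrow> complex) \<Rightarrow> 'g" where
  "t \<alpha> = dual_vec B H \<alpha>"

abbreviation Phi :: "('g \<Rightarrow> complex) set" where
  "Phi \<equiv> roots sc brk H"

lemma weight_spaceI: "(\<And>h. h \<in> H \<Longrightarrow> brk h x = sc (\<mu> h) x) \<Longrightarrow> x \<in> weight_space \<mu>"
  by (simp add: weight_space_def)

lemma weight_spaceD: "x \<in> weight_space \<mu> \<Longrightarrow> h \<in> H \<Longrightarrow> brk h x = sc (\<mu> h) x"
  by (simp add: weight_space_def)

lemma subspace_H: "subspace H"
  using cartan unfolding cartan_subalgebra_def by blast

lemma H_abelian: "h \<in> H \<Longrightarrow> h' \<in> H \<Longrightarrow> brk h h' = 0"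
  using cartan unfolding cartan_subalgebra_def by blast

lemma H_self_centralizing: "(\<And>h. h \<in> H \<Longrightarrow> brk h x = 0) \<Longrightarrow> x \<in> H"
  using cartan unfolding cartan_subalgebra_def by blast

lemma span_eigenvectors_H: "h \<in> H \<Longrightarrow> span {v. \<exists>a. brk h v = sc a v} = UNIV"
  using cartan unfolding cartan_subalgebra_def diagonalizable_def by blast

lemma weight_space_zero: "(\<And>h. h \<in> H \<Longrightarrow> \<mu> h = 0) \<Longrightarrow> weight_space \<mu> = H"
  using H_abelian H_self_centralizing by (auto simp: weight_space_def)

lemma subspace_weight_space: "subspace (weight_space \<mu>)"
  by (rule subspaceI)
    (auto simp: weight_space_def brk_add_right brk_scale_right scale_right_distrib mult.commute)

lemma finite_independent: "independent S \<Longrightarrow> finite S"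
  using finite_dimensional independent_span_bound[of _ S] by auto

text \<open>Commuting diagonalizable operators are simultaneously diagonalizable: the common
eigenspaces of the operators treated so far are invariant under the next one.\<close>

lemma span_common_eigenvectors:
  assumes "finite S" "S \<subseteq> H"
  shows "span {v. \<exists>c. \<forall>h\<in>S. brk h v = sc (c h) v} = UNIV"
  using assms
proof (induction S rule: finite_induct)
  case empty
  show ?case by simp
next
  case (insert h S)
  let ?E = "\<lambda>S. {v. \<exists>c. \<forall>h\<in>S. brk h v = sc (c h) v}"
  have "v \<in> span (?E (insert h S))" if "v \<in> ?E S" for v
  proof -
    from that obtain c where c: "\<And>s. s \<in> S \<Longrightarrow> brk s v = sc (c s) v" by blast
    define W where "W = {w. \<forall>s\<in>S. brk s w = sc (c s) w}"
    have W: "subspace W"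
      by (rule subspaceI)
        (auto simp: W_def brk_add_right brk_scale_right scale_right_distrib mult.commute)
    have inv: "brk h w \<in> W" if "w \<in> W" for w
    proof -
      have "brk s (brk h w) = sc (c s) (brk h w)" if "s \<in> S" for s
        using \<open>w \<in> W\<close> that insert.prems H_abelian[of s h]
        by (simp add: brk_brk_right[of s h] W_def brk_scale_right subset_iff)
      then show ?thesis by (simp add: W_def)
    qed
    have "v \<in> span {v. \<exists>a. brk h v = sc a v}"
      using span_eigenvectors_H insert.prems by simp
    from span_eigenvectors_sum[OF this linear_brk_right] obtain I f
      where f: "finite I" "\<And>a. brk h (f a) = sc a (f a)" "v = (\<Sum>a\<in>I. f a)" by blast
    have "f a \<in> ?E (insert h S)" if "a \<in> I" for a
    proof -
      have "f a \<in> W"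
        using eigencomponents_in_invariant_subspace[OF f(1) W inv linear_brk_right f(2)] that c
        by (simp add: f(3)[symmetric] W_def)
      then have "\<forall>s\<in>insert h S. brk s (f a) = sc ((c(h := a)) s) (f a)"
        using insert.hyps f(2) by (auto simp: W_def)
      then show ?thesis by blast
    qed
    then show ?thesis
      unfolding f(3) by (intro span_sum span_base)
  qed
  then have "span (?E S) \<subseteq> span (?E (insert h S))"
    by (intro span_minimal) (auto simp del: insert_iff)
  then show ?case
    using insert by auto
qed

text \<open>A finite spanning set of \<open>H\<close> suffices, because a common eigenvector of a
set is one of its span.\<close>

lemma span_weight_vectors: "span (\<Union>\<mu>. weight_space \<mu>) = UNIV"
proof -
  obtain S where S: "S \<subseteq> H" "independent S" "H \<subseteq> span S"
    using maximal_independent_subset[of H] by blast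
  have "v \<in> (\<Union>\<mu>. weight_space \<mu>)" if "\<forall>s\<in>S. brk s v = sc (c s) v" for v c
  proof -
    have "\<exists>a. brk h v = sc a v" if "h \<in> span S" for h
      using that
    proof (induction h rule: span_induct_alt)
      case base
      show ?case by (rule exI[of _ 0]) simp
    next
      case (step a s h)
      then obtain b where "brk h v = sc b v" by blast
      then have "brk (sc a s + h) v = sc (a * c s + b) v"
        using that step \<open>\<forall>s\<in>S. _\<close> by (simp add: brk_add_left brk_scale_left scale_left_distrib)
      then show ?case by blast
    qed
    then have "\<forall>h\<in>H. \<exists>a. brk h v = sc a v"
      using S by blast
    then obtain \<mu> where "\<forall>h\<in>H. brk h v = sc (\<mu> h) v" by metis
    then show ?thesis by (auto simp: weight_space_def)
  qed
  then have "{v. \<exists>c. \<forall>h\<in>S. brk h v = sc (c h) v} \<subseteq> (\<Union>\<mu>. weight_space \<mu>)" by blast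
  then show ?thesis
    using span_common_eigenvectors[of S] finite_independent[OF S(2)] S(1) span_mono by blast
qed

lemma weight_vector_induct [consumes 0, case_names zero weight add]:
  assumes "P 0" "\<And>\<mu> x. x \<in> weight_space \<mu> \<Longrightarrow> P x" "\<And>x y. P x \<Longrightarrow> P y \<Longrightarrow> P (x + y)"
  shows "P x"
proof -
  have "x \<in> span (\<Union>\<mu>. weight_space \<mu>)"
    by (simp add: span_weight_vectors)
  then show ?thesis
  proof (induction x rule: span_induct_alt)
    case (step c x y)
    then obtain \<mu> where "x \<in> weight_space \<mu>" by blast
    then show ?case
      using step subspace_scale[OF subspace_weight_space] assms by blast
  qed (rule assms)
qed

lemma brk_weight_space:
  assumes "x \<in> weight_space \<mu>" "y \<in> weight_space \<nu>"
  shows "brk x y \<in> weight_space (\<lambda>h. \<mu> h + \<nu> h)"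
  using assms
  by (auto intro!: weight_spaceI simp: brk_brk_right[of _ x y] weight_spaceD brk_scale_left
      brk_scale_right scale_left_distrib)

lemma B_weight_space:
  assumes "x \<in> weight_space \<mu>" "y \<in> weight_space \<nu>" "h \<in> H" "\<mu> h + \<nu> h \<noteq> 0"
  shows "B x y = 0"
proof -
  have "\<mu> h * B x y = - (\<nu> h * B x y)"
    using B_brk_left[of h x y] assms(1-3) by (simp add: weight_spaceD B_scale_left B_scale_right)
  then have "(\<mu> h + \<nu> h) * B x y = 0"
    by (simp add: distrib_right)
  with assms(4) show ?thesis by simp
qed

text \<open>Nondegeneracy provides some weight vector not orthogonal to \<open>x\<close>, and
orthogonality of weight spaces forces its weight.\<close>

lemma weight_vector_partner:
  assumes "x \<in> weight_space \<mu>" "x \<noteq> 0"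
  obtains y where "y \<in> weight_space (\<lambda>h. - \<mu> h)" "B x y = 1"
proof -
  have "\<exists>\<nu> y. y \<in> weight_space \<nu> \<and> B x y \<noteq> 0"
  proof (rule ccontr)
    assume *: "\<not> ?thesis"
    have "B x y = 0" for y
      by (induction y rule: weight_vector_induct) (use * in \<open>auto simp: B_add_right\<close>)
    with assms(2) B_nondegenerate show False by blast
  qed
  then obtain \<nu> y where y: "y \<in> weight_space \<nu>" "B x y \<noteq> 0" by blast
  have "\<nu> h = - \<mu> h" if "h \<in> H" for h
    using B_weight_space[OF assms(1) y(1) that] y(2) by (metis add.commute eq_neg_iff_add_eq_0)
  then have "y \<in> weight_space (\<lambda>h. - \<mu> h)"
    using y(1) by (simp add: weight_space_def)
  then have "sc (1 / B x y) y \<in> weight_space (\<lambda>h. - \<mu> h)"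
    by (rule subspace_scale[OF subspace_weight_space])
  moreover have "B x (sc (1 / B x y) y) = 1"
    using y by (simp add: B_scale_right)
  ultimately show ?thesis by (rule that)
qed

text \<open>A finite spanning set \<open>E\<close> of weight vectors suffices: a weight vector is
not orthogonal to some element of \<open>E\<close>, hence has the negative of that
element's weight.\<close>

lemma finite_weights:
  obtains F where "finite F" "\<And>\<mu> x. x \<in> weight_space \<mu> \<Longrightarrow> x \<noteq> 0 \<Longrightarrow> \<exists>\<nu>\<in>F. \<forall>h\<in>H. \<mu> h = \<nu> h"
proof -
  obtain E where E: "E \<subseteq> (\<Union>\<mu>. weight_space \<mu>)" "independent E" "(\<Union>\<mu>. weight_space \<mu>) \<subseteq> span E"
    using maximal_independent_subset[of "\<Union>\<mu>. weight_space \<mu>"] by blast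
  then have span: "span E = UNIV"
    using span_minimal[OF E(3) subspace_span] span_weight_vectors by blast
  from E(1) have "\<forall>b\<in>E. \<exists>\<mu>. b \<in> weight_space \<mu>" by blast
  then obtain w where w: "\<And>b. b \<in> E \<Longrightarrow> b \<in> weight_space (w b)" by metis
  show ?thesis
  proof (rule that)
    show "finite ((\<lambda>b h. - w b h) ` E)"
      using finite_independent[OF E(2)] by simp
    fix \<mu> x
    assume x: "x \<in> weight_space \<mu>" "x \<noteq> 0"
    have "\<exists>b\<in>E. B x b \<noteq> 0"
    proof (rule ccontr)
      assume *: "\<not> ?thesis"
      have "B x y = 0" if "y \<in> span E" for y
        using that * by (induction y rule: span_induct_alt) (auto simp: B_add_right B_scale_right)
      with x(2) B_nondegenerate span show False by blast
    qed
    then obtain b where b: "b \<in> E" "B x b \<noteq> 0" by blast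
    have "\<mu> h = - w b h" if "h \<in> H" for h
      using B_weight_space[OF x(1) w[OF b(1)] that] b(2) by (metis eq_neg_iff_add_eq_0)
    then show "\<exists>\<nu>\<in>(\<lambda>b h. - w b h) ` E. \<forall>h\<in>H. \<mu> h = \<nu> h"
      using b(1) by (intro bexI[of _ "\<lambda>h. - w b h"]) auto
  qed
qed

text \<open>Nonzero terms of the sequence would have infinitely many different weights.\<close>

lemma weight_string_terminates:
  assumes "\<And>m::nat. v m \<in> weight_space (\<mu> m)" "h \<in> H" "a \<noteq> 0"
    and "\<And>m. \<mu> m h = c + of_nat m * a"
  shows "\<exists>m. v m = 0"
proof (rule ccontr)
  assume nz: "\<nexists>m. v m = 0"
  obtain F where F: "finite F"
    "\<And>\<mu> x. x \<in> weight_space \<mu> \<Longrightarrow> x \<noteq> 0 \<Longrightarrow> \<exists>\<nu>\<in>F. \<forall>h\<in>H. \<mu> h = \<nu> h"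
    using finite_weights by blast
  have "\<mu> m h \<in> (\<lambda>\<nu>. \<nu> h) ` F" for m
    using F(2)[OF assms(1)[of m]] nz assms(2) by force
  then have "range (\<lambda>m. \<mu> m h) \<subseteq> (\<lambda>\<nu>. \<nu> h) ` F" by blast
  then have "finite (range (\<lambda>m. \<mu> m h))"
    using F(1) finite_subset by blast
  moreover have "inj (\<lambda>m. \<mu> m h)"
    using assms(3) by (intro injI) (simp add: assms(4))
  ultimately show False
    using finite_imageD infinite_UNIV_nat by blast
qed

lemma weight_space_funpow:
  assumes "y \<in> weight_space \<beta>" "v \<in> weight_space \<mu>"
  shows "(brk y ^^ m) v \<in> weight_space (\<lambda>h. \<mu> h + of_nat m * \<beta> h)"
proof (induction m)
  case (Suc m)
  have "(\<lambda>h. \<beta> h + (\<mu> h + of_nat m * \<beta> h)) = (\<lambda>h. \<mu> h + of_nat (Suc m) * \<beta> h)"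
    by (simp add: algebra_simps)
  with brk_weight_space[OF assms(1) Suc] show ?case by simp
qed (use assms in simp)

lemma funpow_brk_vanishes:
  assumes "y \<in> weight_space \<beta>" "v \<in> weight_space \<mu>" "h \<in> H" "\<beta> h \<noteq> 0"
  shows "\<exists>m. (brk y ^^ m) v = 0"
  by (rule weight_string_terminates[OF weight_space_funpow[OF assms(1,2)] assms(3,4)]) simp

text \<open>With \<open>s = [x, y]\<close>, the relation \<open>x y\<^sup>m\<^sup>+\<^sup>1 v =
(\<Sum>i\<le>m. b + i c) y\<^sup>m v\<close> holds. If none of these sums vanished, then
no \<open>y\<^sup>m v\<close> would vanish, contrary to the finiteness of the set of
weights. The lemma is used once with a Heisenberg triple (\<open>c = 0\<close>) and once
with a multiple of an \<open>\<s>\<l>\<^sub>2\<close>-triple.\<close>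

lemma no_infinite_ladder:
  assumes "y \<in> weight_space \<beta>" "v \<in> weight_space \<mu>" "h \<in> H" "\<beta> h \<noteq> 0"
    and v: "v \<noteq> 0" "brk x v = 0" "brk s v = sc b v"
    and s: "brk x y = s" "brk s y = sc c y"
  shows "\<exists>m. (\<Sum>i\<le>m. b + of_nat i * c) = 0"
proof (rule ccontr)
  assume nz: "\<not> ?thesis"
  have sv: "brk s ((brk y ^^ m) v) = sc (b + of_nat m * c) ((brk y ^^ m) v)" for m
  proof (induction m)
    case (Suc m)
    then show ?case
      by (simp add: brk_brk_right[of s y] s brk_scale_left brk_scale_right brk_add_right
          algebra_simps scale_left_distrib)
  qed (simp add: v)
  have xv: "brk x ((brk y ^^ Suc m) v) = sc (\<Sum>i\<le>m. b + of_nat i * c) ((brk y ^^ m) v)" for m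
  proof (induction m)
    case 0
    show ?case by (simp add: brk_brk_right[of x y] s v)
  next
    case (Suc m)
    have "brk x ((brk y ^^ Suc (Suc m)) v) =
        brk s ((brk y ^^ Suc m) v) + brk y (brk x ((brk y ^^ Suc m) v))"
      by (simp add: brk_brk_right[of x y "brk y _"] s)
    also have "\<dots> = sc (b + of_nat (Suc m) * c) ((brk y ^^ Suc m) v)
        + sc (\<Sum>i\<le>m. b + of_nat i * c) ((brk y ^^ Suc m) v)"
      unfolding Suc sv by (simp add: brk_scale_right)
    finally show ?case
      by (simp only: sum.atMost_Suc scale_left_distrib add.commute)
  qed
  have "(brk y ^^ m) v \<noteq> 0" for m
  proof (induction m)
    case (Suc m)
    then have "brk x ((brk y ^^ Suc m) v) \<noteq> 0"
      using nz unfolding xv by simp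
    then show ?case by (metis brk_zero_right)
  qed (use v in simp)
  with funpow_brk_vanishes[OF assms(1-4)] show False by blast
qed


lemma root_weight_vector:
  assumes "\<alpha> \<in> Phi"
  obtains x h where "x \<in> weight_space \<alpha>" "x \<noteq> 0" "h \<in> H" "\<alpha> h \<noteq> 0"
  using assms unfolding roots_def weight_space_def by blast

lemma root_outside: "\<alpha> \<in> Phi \<Longrightarrow> h \<notin> H \<Longrightarrow> \<alpha> h = 0"
  by (simp add: roots_def)

lemma rootI:
  assumes "x \<in> weight_space \<alpha>" "x \<noteq> 0" "h \<in> H" "\<alpha> h \<noteq> 0" "\<And>h. h \<notin> H \<Longrightarrow> \<alpha> h = 0"
  shows "\<alpha> \<in> Phi"
  using assms unfolding roots_def weight_space_def by blast

lemma root_minus: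
  assumes "\<alpha> \<in> Phi"
  shows "(\<lambda>h. - \<alpha> h) \<in> Phi"
proof -
  obtain x h where x: "x \<in> weight_space \<alpha>" "x \<noteq> 0" "h \<in> H" "\<alpha> h \<noteq> 0"
    using assms by (rule root_weight_vector)
  obtain y where y: "y \<in> weight_space (\<lambda>h. - \<alpha> h)" "B x y = 1"
    using x(1,2) by (rule weight_vector_partner)
  have "y \<noteq> 0"
    using y(2) by auto
  then show ?thesis
    using y(1) x(3,4) root_outside[OF assms] by (intro rootI[of y _ h]) auto
qed

lemma finite_roots: "finite Phi"
proof -
  obtain F where F: "finite F"
    "\<And>\<mu> x. x \<in> weight_space \<mu> \<Longrightarrow> x \<noteq> 0 \<Longrightarrow> \<exists>\<nu>\<in>F. \<forall>h\<in>H. \<mu> h = \<nu> h"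
    using finite_weights by blast
  have "\<alpha> \<in> (\<lambda>\<nu> h. if h \<in> H then \<nu> h else 0) ` F" if "\<alpha> \<in> Phi" for \<alpha>
  proof -
    obtain x where "x \<in> weight_space \<alpha>" "x \<noteq> 0"
      using \<open>\<alpha> \<in> Phi\<close> by (rule root_weight_vector)
    with F(2) obtain \<nu> where "\<nu> \<in> F" "\<forall>h\<in>H. \<alpha> h = \<nu> h" by blast
    then show ?thesis
      using root_outside[OF that] by (intro image_eqI[of _ _ \<nu>]) auto
  qed
  then show ?thesis
    using F(1) by (meson finite_imageI finite_subset subsetI)
qed

text \<open>\<open>H\<close> is the zero weight space and hence orthogonal to all other weight
spaces.\<close>

lemma B_nondegenerate_H:
  assumes "z \<in> H" "\<And>h. h \<in> H \<Longrightarrow> B z h = 0"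
  shows "z = 0"
proof -
  have z: "z \<in> weight_space (\<lambda>h. 0)"
    using assms(1) by (simp add: weight_space_zero)
  show ?thesis
  proof (rule B_nondegenerate)
    fix y
    show "B z y = 0"
    proof (induction y rule: weight_vector_induct)
      case (weight \<mu> y)
      show ?case
      proof (cases "\<exists>h\<in>H. \<mu> h \<noteq> 0")
        case True
        then show ?thesis using B_weight_space[OF z weight] by auto
      next
        case False
        then have "y \<in> H"
          using weight weight_space_zero[of \<mu>] by blast
        then show ?thesis by (rule assms(2))
      qed
    qed (simp_all add: B_add_right)
  qed
qed

lemma t_unique:
  assumes "s \<in> H" "\<And>h. h \<in> H \<Longrightarrow> B s h = \<alpha> h"
  shows "t \<alpha> = s"
  unfolding t_def dual_vec_def
proof (rule the_equality)
  fix s' assume s': "s' \<in> H \<and> (\<forall>h\<in>H. B s' h = \<alpha> h)"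
  then have "s' - s = 0"
    using assms by (intro B_nondegenerate_H subspace_diff[OF subspace_H]) (auto simp: B_diff_left)
  then show "s' = s" by simp
qed (use assms in blast)

lemma brk_opposite_in_H:
  assumes "x \<in> weight_space \<alpha>" "y \<in> weight_space (\<lambda>h. - \<alpha> h)"
  shows "brk x y \<in> H"
  using brk_weight_space[OF assms] weight_space_zero[of "\<lambda>h. \<alpha> h + - \<alpha> h"] by simp

lemma B_brk_H:
  assumes "x \<in> weight_space \<alpha>" "h \<in> H"
  shows "B (brk x y) h = \<alpha> h * B x y"
proof -
  have "B (brk x y) h = B (brk h x) y"
    by (simp only: B_inv B_sym[of _ h])
  then show ?thesis
    using assms by (simp add: weight_spaceD B_scale_left)
qed

text \<open>The bracket of a root vector with a suitably scaled partner of opposite weight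
represents \<open>\<alpha>\<close>.\<close>

lemma
  assumes "\<alpha> \<in> Phi"
  shows t_in_H: "t \<alpha> \<in> H" and B_t: "h \<in> H \<Longrightarrow> B (t \<alpha>) h = \<alpha> h"
proof -
  obtain x where x: "x \<in> weight_space \<alpha>" "x \<noteq> 0"
    using assms by (rule root_weight_vector)
  obtain y where y: "y \<in> weight_space (\<lambda>h. - \<alpha> h)" "B x y = 1"
    using x(1,2) by (rule weight_vector_partner)
  have *: "brk x y \<in> H" "h \<in> H \<Longrightarrow> B (brk x y) h = \<alpha> h" for h
    using x y by (simp_all add: brk_opposite_in_H B_brk_H)
  then have "t \<alpha> = brk x y"
    by (rule t_unique)
  with * show "t \<alpha> \<in> H" "h \<in> H \<Longrightarrow> B (t \<alpha>) h = \<alpha> h" by simp_all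
qed

lemma brk_opposite:
  assumes "\<alpha> \<in> Phi" "x \<in> weight_space \<alpha>" "y \<in> weight_space (\<lambda>h. - \<alpha> h)"
  shows "brk x y = sc (B x y) (t \<alpha>)"
proof -
  have "brk x y - sc (B x y) (t \<alpha>) = 0"
    using assms
    by (intro B_nondegenerate_H subspace_diff[OF subspace_H] subspace_scale[OF subspace_H])
      (simp_all add: brk_opposite_in_H t_in_H B_diff_left B_scale_left B_brk_H B_t)
  then show ?thesis by simp
qed

lemma center_trivial:
  assumes "\<And>x. brk z x = 0"
  shows "z = 0"
proof -
  have "lie_ideal {z. \<forall>x. brk z x = 0}"
    unfolding lie_ideal_def
  proof (intro conjI allI ballI)
    show "subspace {z. \<forall>x. brk z x = 0}"
      by (rule subspaceI) (simp_all add: brk_add_left brk_scale_left)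
    fix x y assume "y \<in> {z. \<forall>x. brk z x = 0}"
    then show "brk x y \<in> {z. \<forall>x. brk z x = 0}"
      by (simp add: brk_swap[of x y])
  qed
  moreover have "{z. \<forall>x. brk z x = 0} \<noteq> UNIV"
    using nonabelian by blast
  ultimately show ?thesis
    using only_trivial_ideals assms by blast
qed

text \<open>If \<open>\<alpha>(t\<^sub>\<alpha>) = 0\<close>, then \<open>x\<close>,
\<open>y\<close> and \<open>t\<^sub>\<alpha>\<close> span a Heisenberg algebra. As
\<open>t\<^sub>\<alpha>\<close> is not central, it has a nonzero eigenvalue
\<open>b\<close>; climbing with \<open>x\<close> inside that eigenspace reaches a vector
killed by \<open>x\<close>, from which \<open>y\<close> would start an infinite ladder
with sums \<open>(m + 1) b\<close>.\<close>

lemma root_norm_nonzero: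
  assumes "\<alpha> \<in> Phi"
  shows "\<alpha> (t \<alpha>) \<noteq> 0"
proof
  assume iso: "\<alpha> (t \<alpha>) = 0"
  obtain x h where x: "x \<in> weight_space \<alpha>" "x \<noteq> 0" and h: "h \<in> H" "\<alpha> h \<noteq> 0"
    using assms by (rule root_weight_vector)
  obtain y where y: "y \<in> weight_space (\<lambda>h. - \<alpha> h)" "B x y = 1"
    using x(1,2) by (rule weight_vector_partner)
  have "t \<alpha> \<noteq> 0"
    using B_t[OF assms h(1)] h(2) by auto
  then have "\<exists>\<mu> v. v \<in> weight_space \<mu> \<and> brk (t \<alpha>) v \<noteq> 0"
  proof (rule contrapos_np)
    assume *: "\<not> ?thesis"
    have "brk (t \<alpha>) v = 0" for v
      by (induction v rule: weight_vector_induct) (use * in \<open>auto simp: brk_add_right\<close>)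
    then show "t \<alpha> = 0" by (rule center_trivial)
  qed
  then obtain \<mu> u where u: "u \<in> weight_space \<mu>" "brk (t \<alpha>) u \<noteq> 0" by blast
  define b where "b = \<mu> (t \<alpha>)"
  have tu: "brk (t \<alpha>) u = sc b u"
    using u t_in_H[OF assms] by (simp add: weight_spaceD b_def)
  with u(2) have b: "b \<noteq> 0" and "u \<noteq> 0" by auto
  \<comment> \<open>The last nonzero power of \<open>x\<close> on \<open>u\<close>.\<close>
  define n where "n = (LEAST n. (brk x ^^ n) u = 0)"
  have n: "(brk x ^^ n) u = 0"
    unfolding n_def using funpow_brk_vanishes[OF x(1) u(1) h] by (rule LeastI_ex)
  with \<open>u \<noteq> 0\<close> obtain m where m: "n = Suc m"
    by (cases n) auto
  define v where "v = (brk x ^^ m) u"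
  have v: "v \<in> weight_space (\<lambda>h. \<mu> h + of_nat m * \<alpha> h)"
    unfolding v_def by (rule weight_space_funpow[OF x(1) u(1)])
  have "v \<noteq> 0"
    unfolding v_def using not_less_Least[of m "\<lambda>n. (brk x ^^ n) u = 0"] m by (simp add: n_def)
  moreover have "brk x v = 0"
    using n by (simp add: v_def m)
  moreover have "brk (t \<alpha>) v = sc b v"
    using weight_spaceD[OF v t_in_H[OF assms]] by (simp add: iso b_def)
  moreover have "brk x y = t \<alpha>"
    using brk_opposite[OF assms x(1) y(1)] y(2) by simp
  moreover have "brk (t \<alpha>) y = sc 0 y"
    using weight_spaceD[OF y(1) t_in_H[OF assms]] by (simp add: iso)
  moreover have "- \<alpha> h \<noteq> 0"
    using h(2) by simp
  ultimately have "\<exists>m. (\<Sum>i\<le>m. b + of_nat i * 0) = 0"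
    using no_infinite_ladder[OF y(1) v h(1), of x "t \<alpha>" b 0] h(2) by blast
  with b show False by (simp del: of_nat_Suc)
qed

text \<open>The ladder coefficients of an \<open>\<s>\<l>\<^sub>2\<close>-triple are triangular
numbers up to a factor.\<close>

lemma sum_atMost_ladder: "(\<Sum>i\<le>m. - a + of_nat i * (- a)) = - a * of_nat (\<Sum>i\<le>m. Suc i)" for a :: complex
  by (induction m) (simp_all add: algebra_simps)

text \<open>A second independent vector could be corrected by a multiple of \<open>x\<close> to a
vector \<open>w\<close> orthogonal to \<open>y\<close>, hence killed by
\<open>y\<close>. So \<open>w\<close> would be a lowest weight vector with the weight of
a raising operator, which generates an infinite ladder.\<close>

lemma root_space_one_dimensional:
  assumes "\<alpha> \<in> Phi" "x \<in> weight_space \<alpha>" "y \<in> weight_space (\<lambda>h. - \<alpha> h)" "B x y = 1"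
    and z: "z \<in> weight_space \<alpha>"
  shows "z = sc (B z y) x"
proof (rule ccontr)
  define w where "w = z - sc (B z y) x"
  assume "z \<noteq> sc (B z y) x"
  then have "w \<noteq> 0" by (simp add: w_def)
  have w: "w \<in> weight_space \<alpha>"
    unfolding w_def using assms by (intro subspace_diff subspace_scale subspace_weight_space)
  have "B w y = 0"
    by (simp add: w_def B_diff_left B_scale_left assms(4))
  then have "brk y w = 0"
    using brk_opposite[OF assms(1) w assms(3)] brk_swap[of y w] by simp
  obtain h where h: "h \<in> H" "\<alpha> h \<noteq> 0"
    using assms(1) by (rule root_weight_vector)
  define a where "a = \<alpha> (t \<alpha>)"
  have neg: "brk (- t \<alpha>) v = sc (- a) v" if "v \<in> weight_space \<alpha>" for v
    using weight_spaceD[OF that t_in_H[OF assms(1)]] by (simp add: brk_minus_left a_def)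
  have "brk y x = - t \<alpha>"
    using brk_opposite[OF assms(1-3)] brk_swap[of y x] assms(4) by simp
  then obtain m where "(\<Sum>i\<le>m. - a + of_nat i * (- a)) = 0"
    using no_infinite_ladder[OF assms(2) w h \<open>w \<noteq> 0\<close> \<open>brk y w = 0\<close> neg[OF w] _ neg[OF assms(2)]]
    by blast
  moreover have "a \<noteq> 0"
    unfolding a_def by (rule root_norm_nonzero[OF assms(1)])
  ultimately have "(\<Sum>i\<le>m. Suc i) = 0"
    unfolding sum_atMost_ladder by (simp del: of_nat_sum sum.atMost_Suc sum_eq_0_iff)
  then show False by (cases m) simp_all
qed


text \<open>The condition on \<open>v\<close> is linear, so it can be checked on weight vectors.\<close>

lemma root_space_decomposition:
  assumes X: "\<And>\<alpha>. \<alpha> \<in> Phi \<Longrightarrow> X \<alpha> \<in> weight_space \<alpha>"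
    and Y: "\<And>\<alpha>. \<alpha> \<in> Phi \<Longrightarrow> Y \<alpha> \<in> weight_space (\<lambda>h. - \<alpha> h)"
    and XY: "\<And>\<alpha>. \<alpha> \<in> Phi \<Longrightarrow> B (X \<alpha>) (Y \<alpha>) = 1"
  shows "v - (\<Sum>\<alpha>\<in>Phi. sc (B v (Y \<alpha>)) (X \<alpha>)) \<in> H"
proof (induction v rule: weight_vector_induct)
  case zero
  show ?case by (simp add: subspace_0[OF subspace_H])
next
  case (add v w)
  from subspace_add[OF subspace_H this] show ?case
    by (simp add: B_add_left scale_left_distrib sum.distrib algebra_simps)
next
  case (weight \<mu> v)
  \<comment> \<open>Roots vanish off \<open>H\<close>; \<open>\<mu>\<close> has to be truncated before it can be compared with them.\<close>
  define \<beta> where "\<beta> h = (if h \<in> H then \<mu> h else 0)" for h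
  have v: "v \<in> weight_space \<beta>"
    using weight by (simp add: weight_space_def \<beta>_def)
  have B0: "B v (Y \<alpha>) = 0" if "\<alpha> \<in> Phi" "\<alpha> \<noteq> \<beta>" for \<alpha>
  proof -
    obtain h where "\<alpha> h \<noteq> \<beta> h"
      using \<open>\<alpha> \<noteq> \<beta>\<close> by blast
    then have "h \<in> H" "\<beta> h + - \<alpha> h \<noteq> 0"
      using root_outside[OF that(1), of h] by (auto simp: \<beta>_def split: if_splits)
    then show ?thesis
      using B_weight_space[OF v Y[OF that(1)]] by blast
  qed
  show ?case
  proof (cases "\<beta> \<in> Phi")
    case True
    have "(\<Sum>\<alpha>\<in>Phi. sc (B v (Y \<alpha>)) (X \<alpha>)) = (\<Sum>\<alpha>\<in>Phi. if \<alpha> = \<beta> then v else 0)"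
      using root_space_one_dimensional[OF True X[OF True] Y[OF True] XY[OF True] v]
      by (intro sum.cong) (auto simp: B0)
    also have "\<dots> = v"
      using True finite_roots by simp
    finally show ?thesis
      by (simp add: subspace_0[OF subspace_H])
  next
    case False
    have "v \<in> H"
    proof (cases "v = 0")
      case False
      then have "\<beta> h = 0" if "h \<in> H" for h
        using \<open>\<beta> \<notin> Phi\<close> rootI[OF v _ that] \<beta>_def by metis
      then show ?thesis
        using v weight_space_zero[of \<beta>] by blast
    qed (simp add: subspace_0[OF subspace_H])
    moreover have "B v (Y \<alpha>) = 0" if "\<alpha> \<in> Phi" for \<alpha>
      using B0[OF that] that False by blast
    ultimately show ?thesis by simp
  qed
qed

end

section \<open>The Casimir operator and the dual Coxeter number\<close>

lemma nat_spanE: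
  assumes "f \<in> nat_span \<Delta>"
  obtains m where "f = (\<lambda>h. \<Sum>\<alpha>\<in>\<Delta>. of_nat (m \<alpha>) * \<alpha> h)"
  using assms unfolding nat_span_def by blast

lemma nat_span_add:
  assumes "f \<in> nat_span \<Delta>" "g \<in> nat_span \<Delta>"
  shows "(\<lambda>h. f h + g h) \<in> nat_span \<Delta>"
proof -
  obtain m where m: "f = (\<lambda>h. \<Sum>\<alpha>\<in>\<Delta>. of_nat (m \<alpha>) * \<alpha> h)"
    using assms(1) by (rule nat_spanE)
  obtain n where n: "g = (\<lambda>h. \<Sum>\<alpha>\<in>\<Delta>. of_nat (n \<alpha>) * \<alpha> h)"
    using assms(2) by (rule nat_spanE)
  have "(\<lambda>h. f h + g h) = (\<lambda>h. \<Sum>\<alpha>\<in>\<Delta>. of_nat (m \<alpha> + n \<alpha>) * \<alpha> h)"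
    by (simp add: m n distrib_right sum.distrib)
  then show ?thesis
    unfolding nat_span_def mem_Collect_eq by (intro exI[of _ "\<lambda>\<alpha>. m \<alpha> + n \<alpha>"] conjI TrueI)
qed

text \<open>The sum of the two nonnegative combinations vanishes, so linear independence of the base
makes all coefficients zero.\<close>

lemma nat_span_antisym:
  assumes base: "root_base sc brk H \<Delta>" and f: "f \<in> nat_span \<Delta>" and g: "(\<lambda>h. - f h) \<in> nat_span \<Delta>"
  shows "f h = 0"
proof -
  obtain m where m: "f = (\<lambda>h. \<Sum>\<alpha>\<in>\<Delta>. of_nat (m \<alpha>) * \<alpha> h)"
    using f by (rule nat_spanE)
  obtain n where n: "(\<lambda>h. - f h) = (\<lambda>h. \<Sum>\<alpha>\<in>\<Delta>. of_nat (n \<alpha>) * \<alpha> h)"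
    using g by (rule nat_spanE)
  have "(\<Sum>\<alpha>\<in>\<Delta>. of_nat (m \<alpha> + n \<alpha>) * \<alpha> h) = f h + - f h" for h
    unfolding fun_cong[OF n, of h] by (simp add: m distrib_right sum.distrib)
  then have 0: "\<forall>h. (\<Sum>\<alpha>\<in>\<Delta>. of_nat (m \<alpha> + n \<alpha>) * \<alpha> h) = 0"
    by simp
  have "\<And>c. \<forall>h. (\<Sum>\<alpha>\<in>\<Delta>. c \<alpha> * \<alpha> h) = 0 \<Longrightarrow> \<forall>\<alpha>\<in>\<Delta>. c \<alpha> = 0"
    using base unfolding root_base_def by blast
  from this[OF 0] have "m \<alpha> = 0" if "\<alpha> \<in> \<Delta>" for \<alpha>
    using that by (simp del: of_nat_add)
  then show ?thesis
    by (simp add: m)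
qed

locale cartan_decomposition_with_base = cartan_decomposition sc brk B H
  for sc :: "complex \<Rightarrow> 'g::ab_group_add \<Rightarrow> 'g" and brk B H +
  fixes \<Delta> :: "('g \<Rightarrow> complex) set" and \<theta> :: "'g \<Rightarrow> complex"
  assumes base: "root_base sc brk H \<Delta>"
    and highest: "highest_root sc brk H \<Delta> \<theta>"
    and normalized: "dual_form B H \<theta> \<theta> = 2"
begin

abbreviation Phi_pos :: "('g \<Rightarrow> complex) set" where
  "Phi_pos \<equiv> positive_roots sc brk H \<Delta>"

abbreviation coxeter :: complex where
  "coxeter \<equiv> dual_coxeter_number sc brk B H \<Delta> \<theta>"

lemma highest_is_root: "\<theta> \<in> Phi"
  using highest by (simp add: highest_root_def)

lemma root_nonzero: "\<alpha> \<in> Phi \<Longrightarrow> \<exists>h. \<alpha> h \<noteq> 0"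
  unfolding roots_def by blast

lemma positive_or_negative: "\<alpha> \<in> Phi \<Longrightarrow> \<alpha> \<in> Phi_pos \<or> (\<lambda>h. - \<alpha> h) \<in> Phi_pos"
  using base root_minus unfolding root_base_def positive_roots_def by blast

lemma not_positive_and_negative:
  assumes "\<alpha> \<in> Phi_pos"
  shows "(\<lambda>h. - \<alpha> h) \<notin> Phi_pos"
  using assms nat_span_antisym[OF base, of \<alpha>] root_nonzero[of \<alpha>] unfolding positive_roots_def by blast

lemma sum_roots: "(\<Sum>\<alpha>\<in>Phi. f \<alpha>) = (\<Sum>\<alpha>\<in>Phi_pos. f \<alpha> + f (\<lambda>h. - \<alpha> h))"
proof -
  let ?neg = "\<lambda>(\<alpha> :: 'g \<Rightarrow> complex) h. - \<alpha> h"
  have sub: "Phi_pos \<subseteq> Phi"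
    by (simp add: positive_roots_def)
  have "Phi = Phi_pos \<union> ?neg ` Phi_pos"
  proof
    show "Phi \<subseteq> Phi_pos \<union> ?neg ` Phi_pos"
    proof
      fix \<alpha> assume "\<alpha> \<in> Phi"
      from positive_or_negative[OF this] show "\<alpha> \<in> Phi_pos \<union> ?neg ` Phi_pos"
        by (auto intro: image_eqI[of _ _ "?neg \<alpha>"])
    qed
    show "Phi_pos \<union> ?neg ` Phi_pos \<subseteq> Phi"
      using sub root_minus by blast
  qed
  moreover have "Phi_pos \<inter> ?neg ` Phi_pos = {}"
    using not_positive_and_negative by blast
  moreover have fin: "finite Phi_pos"
    using sub finite_roots finite_subset by blast
  ultimately have "(\<Sum>\<alpha>\<in>Phi. f \<alpha>) = (\<Sum>\<alpha>\<in>Phi_pos. f \<alpha>) + (\<Sum>\<alpha>\<in>?neg ` Phi_pos. f \<alpha>)"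
    by (metis finite_imageI sum.union_disjoint)
  also have "inj_on ?neg Phi_pos"
    by (rule inj_onI) (metis minus_minus ext)
  then have "(\<Sum>\<alpha>\<in>?neg ` Phi_pos. f \<alpha>) = (\<Sum>\<alpha>\<in>Phi_pos. f (?neg \<alpha>))"
    by (simp add: sum.reindex)
  finally show ?thesis
    by (simp add: sum.distrib)
qed

text \<open>If the bracket were nonzero, \<open>\<theta> + \<alpha>\<close> would be a root above
\<open>\<theta>\<close>, or it would be zero; in the second case \<open>\<theta> =
-\<alpha>\<close> would lie below the root \<open>\<alpha>\<close>.\<close>

lemma highest_maximal:
  assumes \<alpha>: "\<alpha> \<in> Phi_pos" and x: "x \<in> weight_space \<alpha>" and z: "z \<in> weight_space \<theta>"
  shows "brk x z = 0"
proof (rule ccontr)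
  let ?\<beta> = "\<lambda>h. \<alpha> h + \<theta> h"
  assume nz: "brk x z \<noteq> 0"
  have xz: "brk x z \<in> weight_space ?\<beta>"
    using x z by (rule brk_weight_space)
  have pos: "\<alpha> \<in> Phi" "\<alpha> \<in> nat_span \<Delta>"
    using \<alpha> by (auto simp: positive_roots_def)
  have max: "(\<lambda>h. \<theta> h - \<beta> h) \<in> nat_span \<Delta>" if "\<beta> \<in> Phi" for \<beta>
    using that highest by (simp add: highest_root_def)
  show False
  proof (cases "\<exists>h\<in>H. ?\<beta> h \<noteq> 0")
    case True
    then have "?\<beta> \<in> Phi"
      using rootI[OF xz nz] root_outside[OF pos(1)] root_outside[OF highest_is_root] by auto
    from max[OF this] have "(\<lambda>h. - \<alpha> h) \<in> nat_span \<Delta>"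
      by simp
    with pos nat_span_antisym[OF base] root_nonzero show False by blast
  next
    case False
    then have eq: "\<theta> h = - \<alpha> h" for h
      using root_outside[OF pos(1)] root_outside[OF highest_is_root]
      by (metis add.commute add.inverse_neutral eq_neg_iff_add_eq_0)
    then have "(\<lambda>h. \<theta> h - \<alpha> h) \<in> nat_span \<Delta>" "(\<lambda>h. - (\<theta> h - \<alpha> h)) = (\<lambda>h. \<alpha> h + \<alpha> h)"
      using max[OF pos(1)] by (simp_all add: fun_eq_iff)
    then have "\<theta> h - \<alpha> h = 0" for h
      using nat_span_antisym[OF base] nat_span_add[OF pos(2) pos(2)] by metis
    then have "\<alpha> h = 0" for h
      using eq[of h] by (simp add: minus_unique neg_eq_iff_add_eq_0 eq_neg_iff_add_eq_0 flip: mult_2)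
    with root_nonzero[OF pos(1)] show False by blast
  qed
qed

text \<open>By the normalization \<open>\<langle>\<theta>, \<theta>\<rangle> = 2\<close>, the coroot
of \<open>\<theta>\<close> is \<open>t\<^sub>\<theta>\<close>.\<close>

lemma two_coxeter: "2 * coxeter = 2 + (\<Sum>\<beta>\<in>Phi_pos. \<beta> (t \<theta>))"
  by (simp add: dual_coxeter_number_def half_sum_positive_roots_def coroot_def normalized t_def)

lemma root_t_swap: "\<alpha> \<in> Phi \<Longrightarrow> \<beta> \<in> Phi \<Longrightarrow> \<alpha> (t \<beta>) = \<beta> (t \<alpha>)"
  by (metis B_sym B_t t_in_H)

end

locale casimir_setup = cartan_decomposition_with_base sc brk B H \<Delta> \<theta>
    + lie_algebra_with_dual_bases sc brk B e e'
  for sc :: "complex \<Rightarrow> 'g::ab_group_add \<Rightarrow> 'g" and brk B H \<Delta> \<theta> and e e' :: "'j::finite \<Rightarrow> 'g"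
begin

text \<open>Only the second factor of the tensor is expanded along the root spaces. The first
factors are then recombined by the expansion in dual bases: those of the Cartan part
into \<open>t\<^sub>\<theta>\<close>, those belonging to \<open>x\<^sub>\<alpha>\<close>
into \<open>y\<^sub>\<alpha>\<close>.\<close>

lemma casimir_highest_root_vector:
  assumes z: "z \<in> weight_space \<theta>"
  shows "casimir z = sc (2 * coxeter) z"
proof -
  have "\<forall>\<alpha>\<in>Phi. \<exists>x y. x \<in> weight_space \<alpha> \<and> y \<in> weight_space (\<lambda>h. - \<alpha> h) \<and> B x y = 1"
    by (metis root_weight_vector weight_vector_partner)
  then obtain X Y where X: "\<And>\<alpha>. \<alpha> \<in> Phi \<Longrightarrow> X \<alpha> \<in> weight_space \<alpha>"
    and Y: "\<And>\<alpha>. \<alpha> \<in> Phi \<Longrightarrow> Y \<alpha> \<in> weight_space (\<lambda>h. - \<alpha> h)"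
    and XY: "\<And>\<alpha>. \<alpha> \<in> Phi \<Longrightarrow> B (X \<alpha>) (Y \<alpha>) = 1"
    by metis
  \<comment> \<open>The orthogonal projection to \<open>H\<close>.\<close>
  define p where "p v = v - (\<Sum>\<alpha>\<in>Phi. sc (B v (Y \<alpha>)) (X \<alpha>))" for v
  have pH: "p v \<in> H" for v
    unfolding p_def by (rule root_space_decomposition[OF X Y XY])
  have B_orth: "B h (X \<alpha>) = 0" if "h \<in> H" "\<alpha> \<in> Phi" for h \<alpha>
  proof -
    obtain h' where "h' \<in> H" "\<alpha> h' \<noteq> 0"
      using \<open>\<alpha> \<in> Phi\<close> by (rule root_weight_vector)
    moreover have "h \<in> weight_space (\<lambda>h. 0)"
      using that(1) by (simp add: weight_space_zero)
    ultimately show ?thesis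
      using B_weight_space[OF _ X[OF that(2)]] by simp
  qed
  let ?t = "t \<theta>"
  have tH: "?t \<in> H" and Bt: "\<And>h. h \<in> H \<Longrightarrow> B ?t h = \<theta> h"
    using t_in_H B_t highest_is_root by blast+
  have \<theta>p: "\<theta> (p v) = B v ?t" for v
  proof -
    have "B ?t (p v) = B ?t v"
      by (simp add: p_def B_diff_right B_sum_right B_scale_right B_orth[OF tH])
    then show ?thesis
      using Bt[OF pH, of v] B_sym[of v ?t] by simp
  qed
  have "brk (e j) (brk (e' j) z) = (\<Sum>\<alpha>\<in>Phi. sc (B (Y \<alpha>) (e' j)) (brk (e j) (brk (X \<alpha>) z)))
      + sc (B ?t (e' j)) (brk (e j) z)" for j
  proof -
    have "brk (e' j) z = brk ((\<Sum>\<alpha>\<in>Phi. sc (B (e' j) (Y \<alpha>)) (X \<alpha>)) + p (e' j)) z"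
      by (simp add: p_def)
    also have "\<dots> = (\<Sum>\<alpha>\<in>Phi. sc (B (e' j) (Y \<alpha>)) (brk (X \<alpha>) z)) + sc (B (e' j) ?t) z"
      by (simp add: brk_add_left brk_sum_left brk_scale_left weight_spaceD[OF z pH] \<theta>p)
    finally show ?thesis
      by (simp add: brk_add_right brk_sum_right brk_scale_right B_sym[of "e' j"])
  qed
  then have "casimir z = (\<Sum>j\<in>UNIV. \<Sum>\<alpha>\<in>Phi. sc (B (Y \<alpha>) (e' j)) (brk (e j) (brk (X \<alpha>) z)))
      + (\<Sum>j\<in>UNIV. sc (B ?t (e' j)) (brk (e j) z))"
    by (simp add: casimir_def sum.distrib)
  also have "(\<Sum>j\<in>UNIV. sc (B ?t (e' j)) (brk (e j) z)) = brk ?t z"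
    by (simp flip: brk_scale_left brk_sum_left add: basis_expansion)
  also have "brk ?t z = sc 2 z"
    using normalized Bt[OF tH] unfolding weight_spaceD[OF z tH] by (simp add: dual_form_def t_def)
  also have "(\<Sum>j\<in>UNIV. \<Sum>\<alpha>\<in>Phi. sc (B (Y \<alpha>) (e' j)) (brk (e j) (brk (X \<alpha>) z)))
      = (\<Sum>\<alpha>\<in>Phi. \<Sum>j\<in>UNIV. sc (B (Y \<alpha>) (e' j)) (brk (e j) (brk (X \<alpha>) z)))"
    by (rule sum.swap)
  also have "\<dots> = (\<Sum>\<alpha>\<in>Phi. brk (Y \<alpha>) (brk (X \<alpha>) z))"
    by (simp flip: brk_scale_left brk_sum_left add: basis_expansion)
  also have "\<dots> = (\<Sum>\<alpha>\<in>Phi_pos. sc (\<alpha> ?t) z)"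
    unfolding sum_roots
  proof (rule sum.cong[OF refl])
    fix \<alpha> assume \<alpha>: "\<alpha> \<in> Phi_pos"
    then have root: "\<alpha> \<in> Phi" by (simp add: positive_roots_def)
    let ?m = "\<lambda>h. - \<alpha> h"
    have m: "?m \<in> Phi"
      using root by (rule root_minus)
    have Xm: "X ?m \<in> weight_space ?m" and Ym: "Y ?m \<in> weight_space \<alpha>"
      using X[OF m] Y[OF m] by simp_all
    have "brk (Y \<alpha>) (brk (X \<alpha>) z) = 0"
      using highest_maximal[OF \<alpha> X[OF root] z] by simp
    moreover have "brk (Y ?m) (brk (X ?m) z) = brk (brk (Y ?m) (X ?m)) z"
      using highest_maximal[OF \<alpha> Ym z] by (simp add: brk_brk_right[of "Y ?m"])
    moreover have "brk (Y ?m) (X ?m) = t \<alpha>"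
      using brk_opposite[OF root Ym Xm] XY[OF m] by (simp add: B_sym)
    moreover have "brk (t \<alpha>) z = sc (\<alpha> ?t) z"
      using weight_spaceD[OF z t_in_H[OF root]] root_t_swap[OF root highest_is_root] by simp
    ultimately show "brk (Y \<alpha>) (brk (X \<alpha>) z) + brk (Y ?m) (brk (X ?m) z) = sc (\<alpha> ?t) z"
      by simp
  qed
  finally show ?thesis
    by (simp only: two_coxeter scale_sum_left scale_left_distrib add.commute)
qed

text \<open>The eigenspace of the Casimir operator is an ideal, and it contains the highest root
vectors.\<close>

theorem casimir_eq: "casimir x = sc (2 * coxeter) x"
proof -
  let ?I = "{x. casimir x = sc (2 * coxeter) x}"
  interpret C: Vector_Spaces.linear sc sc casimir by (rule linear_casimir)
  have "lie_ideal ?I"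
    unfolding lie_ideal_def
  proof (intro conjI allI ballI)
    show "subspace ?I"
      by (rule subspaceI) (simp_all add: C.zero C.add C.scale scale_right_distrib mult.commute)
    show "brk x y \<in> ?I" if "y \<in> ?I" for x y
      using that brk_casimir[of x y] by (simp add: brk_scale_right)
  qed
  moreover obtain z where "z \<in> weight_space \<theta>" "z \<noteq> 0"
    using highest_is_root by (rule root_weight_vector)
  then have "z \<in> ?I" "z \<noteq> 0"
    using casimir_highest_root_vector by simp_all
  ultimately have "?I = UNIV"
    using only_trivial_ideals by blast
  then show ?thesis by blast
qed

end

section \<open>The symmetric step function\<close>

text \<open>The value \<open>1/2\<close> at \<open>0\<close> makes \<open>step (- s) = 1 - step
s\<close> hold without exception. It also accounts for the factor \<open>1/2\<close> in
front of the terms at \<open>n\<^sub>k/2\<close>.\<close>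

definition step :: "int \<Rightarrow> complex" where
  "step s = (if s < 0 then 1 else if s = 0 then 1 / 2 else 0)"

lemma step_reflect: "step (- s) = 1 - step s"
  by (simp add: step_def)

lemma sum_reflect_int: "(\<Sum>p\<in>{a..b::int}. f p) = (\<Sum>p\<in>{a..b}. f (a + b - p))"
  by (rule sum.reindex_bij_witness[of _ "\<lambda>p. a + b - p" "\<lambda>p. a + b - p"]) auto

text \<open>The reflection \<open>p \<mapsto> N - p\<close> of the interval shows that the second
summand contributes half the number of its points; the first is counted directly.\<close>

lemma sum_step_half:
  assumes "\<bar>N\<bar> \<le> K"
  shows "(\<Sum>p\<in>{-K..N+K}. step (p - N) - step (2 * p - N)) = of_int N / 2"
proof -
  let ?I = "{-K..N+K}"
  have card: "of_nat (card {a..b}) = (of_int (b - a + 1) :: complex)" if "a \<le> b + 1" for a b :: int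
    using that by (simp add: of_nat_nat)
  have "(\<Sum>p\<in>?I. step (2 * p - N)) = (\<Sum>p\<in>?I. step (- (2 * p - N)))"
    by (subst sum_reflect_int) (simp add: algebra_simps)
  also have "\<dots> = of_nat (card ?I) - (\<Sum>p\<in>?I. step (2 * p - N))"
    by (simp only: step_reflect sum_subtractf) simp
  finally have 1: "2 * (\<Sum>p\<in>?I. step (2 * p - N)) = of_int N + 2 * of_int K + 1"
    using assms by (simp add: card del: card_atLeastAtMost_int)
  have "(\<Sum>p\<in>?I. step (p - N)) = (\<Sum>p\<in>{-K..N}. step (p - N))"
    using assms by (intro sum.mono_neutral_right) (auto simp: step_def)
  also have "{-K..N} = insert N {-K..N - 1}"
    using assms by auto
  also have "(\<Sum>p\<in>\<dots>. step (p - N)) = step 0 + (\<Sum>p\<in>{-K..N - 1}. 1)"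
    by (simp add: step_def)
  also have "\<dots> = of_int N + of_int K + 1 / 2"
    using assms by (simp add: card step_def del: card_atLeastAtMost_int)
  finally show ?thesis
    using 1 by (simp add: sum_subtractf field_simps)
qed

lemma Sum_any_eq_sum:
  assumes "finite S" "\<And>a. a \<notin> S \<Longrightarrow> f a = 0"
  shows "Sum_any f = sum f S"
  by (rule Sum_any.expand_superset) (use assms in auto)

section \<open>Commutators with the Sugawara operator\<close>

locale sugawara_module =
  lie_algebra_with_dual_bases sc brk B e e' +
  lie_module "toroidal_scale sc" "toroidal_bracket sc brk B k" scaleV act
  for sc :: "complex \<Rightarrow> 'g::ab_group_add \<Rightarrow> 'g" and brk B
    and e e' :: "'j::finite \<Rightarrow> 'g" and k :: "'k::finite"
    and scaleV :: "complex \<Rightarrow> 'v::ab_group_add \<Rightarrow> 'v"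
    and act :: "('g, 'k) toroidal \<Rightarrow> 'v \<Rightarrow> 'v"
begin

abbreviation op :: "'g \<Rightarrow> int ^ 'k \<Rightarrow> 'v \<Rightarrow> 'v" where
  "op a m v \<equiv> act (loop a m) v"

lemma op_add: "op (a + b) m v = op a m v + op b m v"
  unfolding act_add_left[symmetric] by (simp add: loop_def single_add)

lemma op_scale: "op (sc c a) m v = scaleV c (op a m v)"
  unfolding act_scale_left[symmetric] by (simp add: loop_def toroidal_scale_def)

lemma act_zero [simp]: "act X 0 = 0"
  using act_add_right[of X 0 0] by simp

lemma op_zero [simp]: "op 0 m v = 0"
  using op_add[of 0 0] by simp

lemma op_minus: "op (- a) m v = - op a m v"
  using op_add[of a "- a" m v] by (simp add: eq_neg_iff_add_eq_0 add.commute)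

lemma op_sum: "op (\<Sum>j\<in>J. f j) m v = (\<Sum>j\<in>J. op (f j) m v)"
  by (induction J rule: infinite_finite_induct) (simp_all add: op_add)

lemma act_sum: "act X (\<Sum>j\<in>J. f j) = (\<Sum>j\<in>J. act X (f j))"
  by (induction J rule: infinite_finite_induct) (simp_all add: act_add_right)

lemma op_commutator:
  assumes "m + p \<noteq> 0"
  shows "op a m (op b p v) = op b p (op a m v) + op (brk a b) (m + p) v"
  using act_brk[of "loop a m" "loop b p" v] assms unfolding tbrk_loop_loop by simp

lemma bilinear_op_op: "bilinear_map sc scaleV (\<lambda>a b. op a m (op b p v))"
  unfolding bilinear_map_def
  by (intro conjI allI; unfold_locales)
    (simp_all add: op_add op_scale act_add_right act_scale_right V.scale_right_distrib V.scale_left_distrib)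

lemma bilinear_op_brk_op: "bilinear_map sc scaleV (\<lambda>a b. op (brk x b) m (op a p v))"
  unfolding bilinear_map_def
  by (intro conjI allI; unfold_locales)
    (simp_all add: op_add op_scale act_add_right act_scale_right brk_add_right brk_scale_right
      V.scale_right_distrib V.scale_left_distrib)

text \<open>Normal ordering in the negative modes exchanges the two dual bases, which the symmetric
tensor does not notice.\<close>

lemma sum_normal_ordered:
  "(\<Sum>j\<in>UNIV. normal_ordered act k (e j) (e' j) d w) =
    (\<Sum>j\<in>UNIV. op (e j) (axis k (- \<bar>d\<bar>)) (op (e' j) (axis k \<bar>d\<bar>) w))"
proof (cases "d \<ge> 0")
  case False
  then show ?thesis
    using sum_dual_bases_swap[OF bilinear_op_op, of "axis k d" "axis k (- d)" w]
    by (simp add: normal_ordered_def)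
qed (simp add: normal_ordered_def)

lemma sugawara_finite_sum:
  assumes "\<And>a m. m $ k > D \<Longrightarrow> op a m w = 0" "D \<ge> 0"
  shows "sugawara scaleV act k e e' w =
    scaleV (1/2) (\<Sum>d\<in>{-D..D}. \<Sum>j\<in>UNIV. op (e j) (axis k (- \<bar>d\<bar>)) (op (e' j) (axis k \<bar>d\<bar>) w))"
proof -
  have "Sum_any (\<lambda>d. normal_ordered act k a b d w) = (\<Sum>d\<in>{-D..D}. normal_ordered act k a b d w)" for a b
    using assms by (intro Sum_any_eq_sum) (auto simp: normal_ordered_def)
  then show ?thesis
    unfolding sugawara_def sum_normal_ordered[symmetric] by (simp only: sum.swap[of _ UNIV "{-D..D}"])
qed

text \<open>Coefficients of the two infinite sums in the commutator, distinguished by whether the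
first factor carries the shift \<open>n'\<close>.\<close>

definition shifted :: "'g \<Rightarrow> int ^ 'k \<Rightarrow> 'v \<Rightarrow> int \<Rightarrow> 'v" where
  "shifted x n v p = (\<Sum>j\<in>UNIV. op (e j) (n - axis k (n $ k) + axis k p)
     (op (brk x (e' j)) (axis k (n $ k - p)) v))"

definition unshifted :: "'g \<Rightarrow> int ^ 'k \<Rightarrow> 'v \<Rightarrow> int \<Rightarrow> 'v" where
  "unshifted x n v p = (\<Sum>j\<in>UNIV. op (e j) (axis k p) (op (brk x (e' j)) (n - axis k p) v))"

lemma axis_diff: "axis k (a - b) = axis k a - (axis k b :: int ^ 'k)"
  by (simp add: vec_eq_iff axis_def)

lemma axis_minus: "axis k (- b) = - (axis k b :: int ^ 'k)"
  by (simp add: vec_eq_iff axis_def)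

text \<open>The hypothesis on \<open>n\<close> keeps both commutators away from the cocycle.\<close>

lemma commutator_mode_pair:
  fixes n :: "int ^ 'k"
  assumes "\<And>d. n \<noteq> axis k d"
  shows "op x n (\<Sum>j\<in>UNIV. op (e j) (axis k (- d)) (op (e' j) (axis k d) v))
      - (\<Sum>j\<in>UNIV. op (e j) (axis k (- d)) (op (e' j) (axis k d) (op x n v)))
    = - shifted x n v (n $ k - d) + unshifted x n v (- d)"
proof -
  have ne: "n + axis k d \<noteq> 0" for d
    using assms[of "- d"] by (simp add: axis_minus eq_neg_iff_add_eq_0)
  have "op x n (op a (axis k (- d)) (op b (axis k d) v)) - op a (axis k (- d)) (op b (axis k d) (op x n v))
      = op (brk x a) (n + axis k (- d)) (op b (axis k d) v) + op a (axis k (- d)) (op (brk x b) (n + axis k d) v)"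
    for a b
    by (simp add: op_commutator[OF ne, of x a] op_commutator[OF ne, of x b] act_add_right)
  then have "op x n (\<Sum>j\<in>UNIV. op (e j) (axis k (- d)) (op (e' j) (axis k d) v))
      - (\<Sum>j\<in>UNIV. op (e j) (axis k (- d)) (op (e' j) (axis k d) (op x n v)))
    = (\<Sum>j\<in>UNIV. op (brk x (e j)) (n + axis k (- d)) (op (e' j) (axis k d) v))
      + (\<Sum>j\<in>UNIV. op (e j) (axis k (- d)) (op (brk x (e' j)) (n + axis k d) v))"
    by (simp add: act_sum flip: sum_subtractf sum.distrib)
  also have "(\<Sum>j\<in>UNIV. op (brk x (e j)) (n + axis k (- d)) (op (e' j) (axis k d) v))
      = - shifted x n v (n $ k - d)"
    unfolding sum_dual_bases_brk[OF bilinear_op_op] shifted_def by (simp add: axis_diff axis_minus)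
  finally show ?thesis
    by (simp add: unshifted_def axis_minus)
qed

text \<open>Reversing the factors of \<open>shifted\<close> produces the commutators
\<open>[e\<^sub>j, [x, e\<^sup>j]]\<close>, which sum to the negative of the Casimir
operator. The reversed product is \<open>unshifted\<close> by symmetry and invariance of
the tensor.\<close>

lemma shifted_add_unshifted:
  fixes n :: "int ^ 'k"
  assumes n: "n \<noteq> 0" and cas: "casimir x = sc (2 * c) x"
  shows "shifted x n v p + unshifted x n v (n $ k - p) = scaleV (- 2 * c) (op x n v)"
proof -
  define m where "m = n - axis k (n $ k) + axis k p"
  define q where "q = (axis k (n $ k - p) :: int ^ 'k)"
  have mq: "m + q = n" "n - q = m"
    by (simp_all add: m_def q_def axis_diff)
  have "shifted x n v p = (\<Sum>j\<in>UNIV. op (brk x (e' j)) q (op (e j) m v))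
      + (\<Sum>j\<in>UNIV. op (brk (e j) (brk x (e' j))) n v)"
    unfolding shifted_def m_def[symmetric] q_def[symmetric]
    using n by (simp add: op_commutator[of m q] mq sum.distrib)
  also have "(\<Sum>j\<in>UNIV. op (brk x (e' j)) q (op (e j) m v)) = (\<Sum>j\<in>UNIV. op (brk x (e j)) q (op (e' j) m v))"
    by (rule sum_dual_bases_swap[OF bilinear_op_brk_op])
  also have "\<dots> = - unshifted x n v (n $ k - p)"
    unfolding sum_dual_bases_brk[OF bilinear_op_op] unshifted_def q_def[symmetric] mq ..
  also have "(\<Sum>j\<in>UNIV. op (brk (e j) (brk x (e' j))) n v) = op (- casimir x) n v"
    unfolding op_sum[symmetric] casimir_def sum_negf[symmetric]
    by (simp add: brk_swap[of x] brk_minus_right)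
  finally show ?thesis
    by (simp add: cas op_minus op_scale)
qed

text \<open>The modes \<open>d\<close> and \<open>-d\<close> of the Sugawara operator contribute
equally. Folding its factor \<open>1/2\<close> onto the nonpositive modes leaves weight
\<open>1\<close> for negative modes and weight \<open>1/2\<close> for the zero mode,
that is, \<open>step\<close>.\<close>

lemma commutator_sugawara_steps:
  fixes n :: "int ^ 'k"
  assumes n: "\<And>d. n \<noteq> axis k d"
    and D: "\<And>a m. m $ k > D \<Longrightarrow> op a m v = 0" "\<And>a m. m $ k > D \<Longrightarrow> op a m (op x n v) = 0" "D \<ge> 0"
  shows "op x n (sugawara scaleV act k e e' v) - sugawara scaleV act k e e' (op x n v) =
    - (\<Sum>q\<in>{-D..D}. scaleV (step q) (shifted x n v (n $ k + q)))
    + (\<Sum>q\<in>{-D..D}. scaleV (step q) (unshifted x n v q))"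
proof -
  have fold: "scaleV (1/2) (\<Sum>d\<in>{-D..D}. f (- \<bar>d\<bar>)) = (\<Sum>q\<in>{-D..D}. scaleV (step q) (f q))" for f
  proof -
    have "scaleV (step d) (f d) + scaleV (step (- d)) (f (- d)) = f (- \<bar>d\<bar>)" for d
      by (cases d "0::int" rule: linorder_cases) (simp_all add: step_def flip: V.scale_left_distrib)
    then have "(\<Sum>d\<in>{-D..D}. f (- \<bar>d\<bar>)) =
        (\<Sum>d\<in>{-D..D}. scaleV (step d) (f d)) + (\<Sum>d\<in>{-D..D}. scaleV (step (- d)) (f (- d)))"
      by (simp flip: sum.distrib)
    also have "(\<Sum>d\<in>{-D..D}. scaleV (step (- d)) (f (- d))) = (\<Sum>d\<in>{-D..D}. scaleV (step d) (f d))"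
      using sum_reflect_int[of "\<lambda>d. scaleV (step d) (f d)" "-D" D] by simp
    also have "(\<Sum>d\<in>{-D..D}. scaleV (step d) (f d)) + (\<Sum>d\<in>{-D..D}. scaleV (step d) (f d))
        = scaleV 2 (\<Sum>d\<in>{-D..D}. scaleV (step d) (f d))"
      using V.scale_left_distrib[of 1 1] by simp
    finally show ?thesis by simp
  qed
  have "op x n (sugawara scaleV act k e e' v) - sugawara scaleV act k e e' (op x n v) =
      scaleV (1/2) (\<Sum>d\<in>{-D..D}. - shifted x n v (n $ k - \<bar>d\<bar>) + unshifted x n v (- \<bar>d\<bar>))"
    by (simp only: sugawara_finite_sum[OF D(1,3)] sugawara_finite_sum[OF D(2,3)] act_scale_right
        act_sum[of _ _ "{-D..D}"] V.scale_right_diff_distrib[symmetric]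
        sum_subtractf[symmetric] commutator_mode_pair[OF n])
  also have "\<dots> = (\<Sum>q\<in>{-D..D}. scaleV (step q) (- shifted x n v (n $ k + q) + unshifted x n v q))"
    using fold[of "\<lambda>q. - shifted x n v (n $ k + q) + unshifted x n v q"] by simp
  finally show ?thesis
    by (simp add: V.scale_right_diff_distrib sum_subtractf)
qed

text \<open>Both cuts are moved to \<open>n\<^sub>k/2\<close>. The range of summation is invariant
under the reflection \<open>p \<mapsto> n\<^sub>k - p\<close>, which matches the change
of weights of \<open>unshifted\<close> with that of \<open>shifted\<close>. The bound
\<open>K\<close> is large enough for all summands with \<open>p < -K\<close> to vanish
on \<open>v\<close>, whatever the sign of \<open>n\<^sub>k\<close>.\<close>

lemma commutator_sugawara_midpoint:
  fixes n :: "int ^ 'k"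
  assumes n: "\<And>d. n \<noteq> axis k d" and cas: "casimir x = sc (2 * c) x"
    and M: "\<And>a m. m $ k > M \<Longrightarrow> op a m v = 0" "\<And>a m. m $ k > M \<Longrightarrow> op a m (op x n v) = 0" "M \<ge> 0"
    and K: "K = M + 2 * \<bar>n $ k\<bar>"
  shows "op x n (sugawara scaleV act k e e' v) - sugawara scaleV act k e e' (op x n v) =
    - (\<Sum>p\<in>{-K..n $ k + K}. scaleV (step (2 * p - n $ k)) (shifted x n v p))
    + (\<Sum>p\<in>{-K..n $ k + K}. scaleV (step (2 * p - n $ k)) (unshifted x n v p))
    + scaleV (c * of_int (n $ k)) (op x n v)"
proof -
  let ?N = "n $ k"
  let ?I = "{-K..?N + K}"
  let ?A = "shifted x n v" and ?C = "unshifted x n v"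
  have "n \<noteq> 0"
    using n[of 0] by (auto simp: axis_def vec_eq_iff)
  define D where "D = M + \<bar>?N\<bar>"
  have A0: "?A p = 0" if "?N - p > M" for p
    using that by (simp add: shifted_def M(1))
  have C0: "?C p = 0" if "?N - p > M" for p
    using that by (simp add: unshifted_def M(1))
  have "(\<Sum>q\<in>{-D..D}. scaleV (step q) (?A (?N + q))) = (\<Sum>p\<in>{?N - D..?N + D}. scaleV (step (p - ?N)) (?A p))"
    by (rule sum.reindex_bij_witness[of _ "\<lambda>p. p - ?N" "\<lambda>q. ?N + q"]) auto
  also have "\<dots> = (\<Sum>p\<in>?I. scaleV (step (p - ?N)) (?A p))"
    using M(3) by (intro sum.mono_neutral_left) (auto simp: K D_def step_def A0)
  finally have A: "(\<Sum>q\<in>{-D..D}. scaleV (step q) (?A (?N + q))) = (\<Sum>p\<in>?I. scaleV (step (p - ?N)) (?A p))" .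
  have C: "(\<Sum>q\<in>{-D..D}. scaleV (step q) (?C q)) = (\<Sum>p\<in>?I. scaleV (step p) (?C p))"
    using M(3) by (intro sum.mono_neutral_left) (auto simp: K D_def step_def C0)
  \<comment> \<open>The change of the weight of \<open>shifted\<close> when its cut moves from \<open>N\<close> to \<open>N/2\<close>.\<close>
  define w where "w p = step (p - ?N) - step (2 * p - ?N)" for p
  have w: "step (?N - p) - step (?N - 2 * p) = - w p" for p
    using step_reflect[of "p - ?N"] step_reflect[of "2 * p - ?N"] by (simp add: w_def)
  have refl: "(\<Sum>p\<in>?I. scaleV (step p - step (2 * p - ?N)) (?C p)) =
      (\<Sum>p\<in>?I. scaleV (- w p) (?C (?N - p)))"
    by (subst sum_reflect_int) (simp add: w)
  have "- (\<Sum>p\<in>?I. scaleV (step (p - ?N)) (?A p)) + (\<Sum>p\<in>?I. scaleV (step p) (?C p))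
      - (- (\<Sum>p\<in>?I. scaleV (step (2 * p - ?N)) (?A p)) + (\<Sum>p\<in>?I. scaleV (step (2 * p - ?N)) (?C p)))
    = (\<Sum>p\<in>?I. scaleV (- w p) (?A p)) + (\<Sum>p\<in>?I. scaleV (step p - step (2 * p - ?N)) (?C p))"
    by (simp add: w_def V.scale_left_diff_distrib sum_subtractf)
  also have "\<dots> = (\<Sum>p\<in>?I. scaleV (- w p) (?A p + ?C (?N - p)))"
    unfolding refl by (simp only: V.scale_right_distrib sum.distrib)
  also have "\<dots> = (\<Sum>p\<in>?I. scaleV (w p) (scaleV (2 * c) (op x n v)))"
    unfolding shifted_add_unshifted[OF \<open>n \<noteq> 0\<close> cas] by simp
  also have "\<dots> = scaleV (\<Sum>p\<in>?I. w p) (scaleV (2 * c) (op x n v))"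
    by (rule V.scale_sum_left[symmetric])
  also have "(\<Sum>p\<in>?I. w p) = of_int ?N / 2"
    unfolding w_def using M(3) by (intro sum_step_half) (simp add: K)
  finally have diff: "- (\<Sum>p\<in>?I. scaleV (step (p - ?N)) (?A p)) + (\<Sum>p\<in>?I. scaleV (step p) (?C p))
      - (- (\<Sum>p\<in>?I. scaleV (step (2 * p - ?N)) (?A p)) + (\<Sum>p\<in>?I. scaleV (step (2 * p - ?N)) (?C p)))
    = scaleV (c * of_int ?N) (op x n v)"
    by (simp add: mult.commute)
  have steps: "op x n (sugawara scaleV act k e e' v) - sugawara scaleV act k e e' (op x n v) =
      - (\<Sum>p\<in>?I. scaleV (step (p - ?N)) (?A p)) + (\<Sum>p\<in>?I. scaleV (step p) (?C p))"
    unfolding A[symmetric] C[symmetric]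
    by (rule commutator_sugawara_steps[OF n]) (use M in \<open>simp_all add: D_def\<close>)
  show ?thesis
    unfolding steps diff[unfolded diff_eq_eq] by (rule add.commute)
qed

text \<open>This is the passage from the finite range back to the infinite sums; the value
\<open>1/2\<close> of \<open>step\<close> is the source of the separate term at
\<open>N/2\<close>.\<close>

lemma sum_step_midpoint:
  assumes "\<And>p. p < - K \<Longrightarrow> f p = 0" "\<bar>N\<bar> \<le> K"
  shows "(\<Sum>p\<in>{-K..N+K}. scaleV (step (2 * p - N)) (f p)) =
    Sum_any (\<lambda>p. if real_of_int p < real_of_int N / 2 then f p else 0)
    + (if even N then scaleV (1/2) (f (N div 2)) else 0)"
proof -
  let ?I = "{-K..N+K}"
  have cond: "real_of_int p < real_of_int N / 2 \<longleftrightarrow> 2 * p - N < 0" for p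
    by linarith
  have mid: "N div 2 \<in> ?I"
    using assms(2) by simp presburger
  have "(\<Sum>p\<in>?I. scaleV (step (2 * p - N)) (f p)) =
      (\<Sum>p\<in>?I. (if 2 * p - N < 0 then f p else 0) + (if p = N div 2 then if even N then scaleV (1/2) (f p) else 0 else 0))"
    by (intro sum.cong refl) (auto simp: step_def)
  also have "\<dots> = (\<Sum>p\<in>?I. if 2 * p - N < 0 then f p else 0) + (if even N then scaleV (1/2) (f (N div 2)) else 0)"
    using mid by (simp add: sum.distrib)
  also have "(\<Sum>p\<in>?I. if 2 * p - N < 0 then f p else 0) = Sum_any (\<lambda>p. if 2 * p - N < 0 then f p else 0)"
    using assms by (intro Sum_any_eq_sum[symmetric]) auto
  finally show ?thesis
    by (simp only: cond)
qed

end


theorem theorem14: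
  fixes sc :: "complex \<Rightarrow> 'g::ab_group_add \<Rightarrow> 'g"
    and brk :: "'g \<Rightarrow> 'g \<Rightarrow> 'g"
    and B :: "'g \<Rightarrow> 'g \<Rightarrow> complex"
    and H :: "'g set"
    and \<Delta> :: "('g \<Rightarrow> complex) set"
    and \<theta> :: "'g \<Rightarrow> complex"
    and e e' :: "'j::finite \<Rightarrow> 'g"
    and k :: "'k::finite"
    and scaleV :: "complex \<Rightarrow> 'v::ab_group_add \<Rightarrow> 'v"
    and act :: "('g, 'k) toroidal \<Rightarrow> 'v \<Rightarrow> 'v"
    and x :: 'g
    and n n' :: "int ^ 'k"
    and v :: 'v
  assumes "simple_lie_algebra sc brk"
    and "cartan_subalgebra sc brk H"
    and "root_base sc brk H \<Delta>"
    and "highest_root sc brk H \<Delta> \<theta>"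
    and "invariant_form sc brk B"
    and "dual_form B H \<theta> \<theta> = 2"
    and "dual_bases sc B e e'"
    and "lie_module (toroidal_scale sc) (toroidal_bracket sc brk B k) scaleV act"
    and "diagonalizable scaleV (act deriv_elt)"
    and "real_eigenvalues_bounded_above scaleV (act deriv_elt)"
    and "n' = n - axis k (n $ k)"
    and "n' \<noteq> 0"
  shows "act (loop x n) (sugawara scaleV act k e e' v) - sugawara scaleV act k e e' (act (loop x n) v) =
      (\<Sum>j\<in>UNIV.
         - Sum_any (\<lambda>d::int. if real_of_int d < real_of_int (n $ k) / 2
             then act (loop (e j) (n' + axis k d))
                    (act (loop (brk x (e' j)) (axis k (n $ k - d))) v)
             else 0)
         + Sum_any (\<lambda>d::int. if real_of_int d < real_of_int (n $ k) / 2
             then act (loop (e j) (axis k d))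
                    (act (loop (brk x (e' j)) (n - axis k d)) v)
             else 0))
      + (if even (n $ k) then
           (\<Sum>j\<in>UNIV.
              - scaleV (1/2) (act (loop (e j) (n' + axis k (n $ k div 2)))
                  (act (loop (brk x (e' j)) (axis k (n $ k div 2))) v))
              + scaleV (1/2) (act (loop (e j) (axis k (n $ k div 2)))
                  (act (loop (brk x (e' j)) (n - axis k (n $ k div 2))) v)))
         else 0)
      + scaleV (dual_coxeter_number sc brk B H \<Delta> \<theta> * of_int (n $ k)) (act (loop x n) v)"
proof -
  interpret casimir_setup sc brk B H \<Delta> \<theta> e e'
  proof -
    interpret simple_lie_algebra sc brk by fact
    show "casimir_setup sc brk B H \<Delta> \<theta> e e'"
      by unfold_locales fact+
  qed
  interpret sugawara_module sc brk B e e' k scaleV act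
  proof -
    interpret lie_module "toroidal_scale sc" "toroidal_bracket sc brk B k" scaleV act by fact
    show "sugawara_module sc brk B e e' k scaleV act"
      by unfold_locales
  qed
  let ?N = "n $ k"
  have n: "n \<noteq> axis k d" for d
    using assms(11,12) by auto
  obtain M1 where M1: "\<And>a m. m $ k > M1 \<Longrightarrow> op a m v = 0"
    using loop_eventually_zero[OF assms(8-10), of v] by blast
  obtain M2 where M2: "\<And>a m. m $ k > M2 \<Longrightarrow> op a m (op x n v) = 0"
    using loop_eventually_zero[OF assms(8-10), of "op x n v"] by blast
  \<comment> \<open>Modes of degree above \<open>M\<close> in the variable \<open>k\<close> annihilate both \<open>v\<close> and \<open>x(n) v\<close>.\<close>
  define M where "M = max 0 (max M1 M2)"
  have M: "op a m v = 0" "op a m (op x n v) = 0" if "m $ k > M" for a m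
    using that M1 M2 by (simp_all add: M_def)
  define K where "K = M + 2 * \<bar>?N\<bar>"
  have "M \<ge> 0" by (simp add: M_def)
  then have K: "\<bar>?N\<bar> \<le> K" "K \<ge> M + \<bar>?N\<bar>" by (simp_all add: K_def)
  let ?a = "\<lambda>j p. op (e j) (n' + axis k p) (op (brk x (e' j)) (axis k (?N - p)) v)"
  let ?c = "\<lambda>j p. op (e j) (axis k p) (op (brk x (e' j)) (n - axis k p) v)"
  have 0: "?a j p = 0" "?c j p = 0" if "p < - K" for j p
    using that K by (simp_all add: M)
  have A: "(\<Sum>p\<in>{-K..?N + K}. scaleV (step (2 * p - ?N)) (shifted x n v p)) =
      (\<Sum>j\<in>UNIV. Sum_any (\<lambda>p. if real_of_int p < real_of_int ?N / 2 then ?a j p else 0)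
        + (if even ?N then scaleV (1/2) (?a j (?N div 2)) else 0))"
    unfolding shifted_def assms(11)[symmetric] V.scale_sum_right
    by (subst sum.swap) (simp only: sum_step_midpoint[OF 0(1) K(1)])
  have C: "(\<Sum>p\<in>{-K..?N + K}. scaleV (step (2 * p - ?N)) (unshifted x n v p)) =
      (\<Sum>j\<in>UNIV. Sum_any (\<lambda>p. if real_of_int p < real_of_int ?N / 2 then ?c j p else 0)
        + (if even ?N then scaleV (1/2) (?c j (?N div 2)) else 0))"
    unfolding unshifted_def V.scale_sum_right
    by (subst sum.swap) (simp only: sum_step_midpoint[OF 0(2) K(1)])
  have half: "?N - ?N div 2 = ?N div 2" if "even ?N"
    using that by presburger
  have "op x n (sugawara scaleV act k e e' v) - sugawara scaleV act k e e' (op x n v) =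
      - (\<Sum>p\<in>{-K..?N + K}. scaleV (step (2 * p - ?N)) (shifted x n v p))
      + (\<Sum>p\<in>{-K..?N + K}. scaleV (step (2 * p - ?N)) (unshifted x n v p))
      + scaleV (coxeter * of_int ?N) (op x n v)"
    by (rule commutator_sugawara_midpoint[OF n casimir_eq _ _ \<open>M \<ge> 0\<close> K_def]) (simp_all add: M)
  then show ?thesis
    unfolding A C
    by (cases "even ?N") (simp_all add: half sum.distrib sum_negf sum_subtractf)
qed

end
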